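(* For every integer $d\geq 2$ let $G:=(\mathbb{Z}/2\mathbb{Z})\wr\mathbb{F}_{d}=\left(\bigoplus_{\mathbb{F}_{d}}\mathbb{Z}/2\mathbb{Z}\right)\rtimes\mathbb{F}_{d}$ be the Lamplighter group of the free group $\mathbb{F}_{d}$ of rank $d$, and let $S$ be a finite symmetric generating set of $G$. Let $\ell$ denote the word-length function on $G$ associated with $S$, and let $D_{\ell}$ be the self-adjoint operator on $\ell^{2}(G)$ with $D_{\ell}\delta_{g}=\ell(g)\delta_{g}$ for all $g\in G$. Then the spectral triple $(\mathbb{C}[G],\ell^{2}(G),D_{\ell})$ over $C_{\mathrm{r}}^{\ast}(G)$ is not a spectral metric space.
   Context: The action of $\mathbb{F}_d$ on $\bigoplus_{\mathbb{F}_{d}}\mathbb{Z}/2\mathbb{Z}$ is by left translation of the index set: identifying an element of $\bigoplus_{\mathbb{F}_{d}}\mathbb{Z}/2\mathbb{Z}$ with the characteristic function $\chi_E$ of a finite set $E\subseteq\mathbb{F}_d$, the multiplication of $G$ is $(\chi_{E},g)(\chi_{F},h)=(\chi_{E\bigtriangleup gF},gh)$, where $\bigtriangleup$ is the symmetric difference. "Symmetric" means $S=S^{-1}$. $(\delta_g)_{g\in G}$ is the standard orthonormal basis of $\ell^2(G)$; $C_{\mathrm{r}}^{\ast}(G)\subseteq\mathcal{B}(\ell^2(G))$ is the reduced group C$^\ast$-algebra, i.e. the norm closure of the group algebra $\mathbb{C}[G]$ acting on $\ell^2(G)$ by the left regular representation. For $a\in\mathbb{C}[G]$ the commutator $[D_\ell,a]=D_\ell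 a-aD_\ell$ extends to a bounded operator on $\ell^2(G)$. A spectral triple $(\mathcal{A},\mathcal{H},D)$ on a separable unital C$^\ast$-algebra $A$ consists of a $\ast$-representation $\pi:A\to\mathcal{B}(\mathcal{H})$, a norm dense unital $\ast$-subalgebra $\mathcal{A}\subseteq A$, and a densely defined self-adjoint operator $D$ on $\mathcal{H}$ such that $(1+D^2)^{-1/2}$ is compact and such that for every $a\in\mathcal{A}$ the domain of $D$ is invariant under $\pi(a)$ and $[D,\pi(a)]$ is bounded. It is non-degenerate if $\pi$ is faithful and $[D,\pi(a)]=0$ if and only if $a\in\mathbb{C}1$. The triple $(\mathbb{C}[G],\ell^{2}(G),D_{\ell})$ is a non-degenerate spectral triple on $C_{\mathrm{r}}^{\ast}(G)$. A non-degenerate spectral triple induces on the state space $\mathcal{S}(A)$ the pseudo-metric (possibly taking the value $+\infty$) \[ d_{D}(\psi,\psi^{\prime}):=\sup\left\{ |\psi(a)-\psi^{\prime}(a)| : a\in\mathcal{A}\text{ with }\Vert[D,a]\Vert\leq1\right\}. \] It is called a spectral metric space if the topology induced by $d_D$ on $\mathcal{S}(A)$ coincides with the weak$^\ast$-topology. *)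

theory Defs
  imports "HOL-Analysis.Analysis" "HOL-Algebra.Generated_Groups"
begin

section \<open>Free groups and lamplighter groups\<close>

text \<open>A letter \<open>(x, True)\<close> stands for the generator \<open>x\<close> and \<open>(x, False)\<close> for its inverse.
  Elements of the free group are freely reduced words.\<close>

definition inv_letter :: "'a \<times> bool \<Rightarrow> 'a \<times> bool"
  where "inv_letter a = (fst a, \<not> snd a)"

definition reduced_word :: "('a \<times> bool) list \<Rightarrow> bool"
  where "reduced_word = successively (\<lambda>a b. b \<noteq> inv_letter a)"

definition reduced_Cons :: "'a \<times> bool \<Rightarrow> ('a \<times> bool) list \<Rightarrow> ('a \<times> bool) list"
  where "reduced_Cons a w =
    (case w of [] \<Rightarrow> [a] | b # v \<Rightarrow> if b = inv_letter a then v else a # w)"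

definition free_group :: "'a set \<Rightarrow> ('a \<times> bool) list monoid"
  where "free_group X =
    \<lparr>carrier = {w. reduced_word w \<and> fst ` set w \<subseteq> X}, mult = foldr reduced_Cons, one = []\<rparr>"

text \<open>The wreath product of \<open>\<int>/2\<close> with \<open>H\<close>: finitely supported functions
  from \<open>H\<close> to \<open>\<int>/2\<close> are identified with their supports.\<close>

definition lamplighter :: "('a, 'b) monoid_scheme \<Rightarrow> ('a set \<times> 'a) monoid"
  where "lamplighter H =
    \<lparr>carrier = {E. finite E \<and> E \<subseteq> carrier H} \<times> carrier H,
     mult = (\<lambda>(E, g) (F, h). (sym_diff E (g <#\<^bsub>H\<^esub> F), g \<otimes>\<^bsub>H\<^esub> h)),
     one = ({}, \<one>\<^bsub>H\<^esub>)\<rparr>"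

lemma reduced_Nil [simp]: "reduced_word []"
  by (simp add: reduced_word_def)

lemma inv_letter_inv_letter [simp]: "inv_letter (inv_letter a) = a"
  by (simp add: inv_letter_def)

lemma inv_letter_neq [simp]: "inv_letter a \<noteq> a" "a \<noteq> inv_letter a"
  by (auto simp: inv_letter_def prod_eq_iff)

lemma fst_inv_letter [simp]: "fst (inv_letter a) = fst a"
  by (simp add: inv_letter_def)

lemma reduced_reduced_Cons: "reduced_word w \<Longrightarrow> reduced_word (reduced_Cons a w)"
  by (auto simp: reduced_word_def reduced_Cons_def successively_Cons split: list.splits)

lemma reduced_foldr: "reduced_word w \<Longrightarrow> reduced_word (foldr reduced_Cons u w)"
  by (induction u) (auto simp: reduced_reduced_Cons)

lemma reduced_Cons_cancel: 
  "reduced_word w \<Longrightarrow> reduced_Cons (inv_letter a) (reduced_Cons a w) = w"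
  by (cases w) (auto simp: reduced_word_def reduced_Cons_def successively_Cons split: list.splits)

lemma reduced_Cons_cancel': 
  "reduced_word w \<Longrightarrow> reduced_Cons a (reduced_Cons (inv_letter a) w) = w"
  using reduced_Cons_cancel[of w "inv_letter a"] by simp

lemma foldr_reduced_Cons:
  assumes "reduced_word w"
  shows "foldr reduced_Cons (reduced_Cons a v) w = reduced_Cons a (foldr reduced_Cons v w)"
proof (cases v)
  case (Cons b v')
  then show ?thesis
    using reduced_Cons_cancel'[OF reduced_foldr[OF assms, of v'], of a]
    by (auto simp: reduced_Cons_def[of a "b # v'"])
qed (simp add: reduced_Cons_def[of a "[]"])

lemma foldr_reduced_Cons_assoc:
  assumes "reduced_word w"
  shows "foldr reduced_Cons (foldr reduced_Cons u v) w =
         foldr reduced_Cons u (foldr reduced_Cons v w)"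
  using assms by (induction u) (auto simp: foldr_reduced_Cons)

lemma foldr_reduced_Cons_Nil: "reduced_word w \<Longrightarrow> foldr reduced_Cons w [] = w"
  by (induction w) (auto simp: reduced_word_def reduced_Cons_def successively_Cons split: list.splits)

lemma foldr_inverse_word:
  "reduced_word w \<Longrightarrow> foldr reduced_Cons (rev (map inv_letter u)) (foldr reduced_Cons u w) = w"
  by (induction u) (auto simp: reduced_Cons_cancel reduced_foldr)

lemma reduced_inverse_word: "reduced_word w \<Longrightarrow> reduced_word (rev (map inv_letter w))"
  unfolding reduced_word_def successively_rev successively_map
  by (erule successively_mono) (metis inv_letter_inv_letter)

lemma set_foldr_reduced_Cons:
  "fst ` set (foldr reduced_Cons u w) \<subseteq> fst ` set u \<union> fst ` set w"
proof (induction u)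
  case (Cons a u)
  have "fst ` set (reduced_Cons a v) \<subseteq> insert (fst a) (fst ` set v)" for v :: "('a \<times> bool) list"
    by (auto simp: reduced_Cons_def split: list.splits)
  from this[of "foldr reduced_Cons u w"] Cons show ?case
    by (simp add: subset_insertI2) blast
qed simp

lemma group_free_group: "group (free_group X)"
proof (rule groupI)
  fix x assume "x \<in> carrier (free_group X)"
  then have "reduced_word x" "fst ` set x \<subseteq> X" by (auto simp: free_group_def)
  then show "\<exists>y\<in>carrier (free_group X). y \<otimes>\<^bsub>free_group X\<^esub> x = \<one>\<^bsub>free_group X\<^esub>"
    using foldr_inverse_word[of "[]" x] foldr_reduced_Cons_Nil[of x]
    by (intro bexI[of _ "rev (map inv_letter x)"])
       (auto simp: free_group_def reduced_inverse_word)
next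
  fix x y
  assume "x \<in> carrier (free_group X)" "y \<in> carrier (free_group X)"
  then show "x \<otimes>\<^bsub>free_group X\<^esub> y \<in> carrier (free_group X)"
    using order_trans[OF set_foldr_reduced_Cons[of x y], of X]
    by (simp add: free_group_def reduced_foldr)
qed (auto simp: free_group_def foldr_reduced_Cons_assoc)

lemma (in group) group_lamplighter: "group (lamplighter G)"
proof (rule groupI)
  fix x assume "x \<in> carrier (lamplighter G)"
  then obtain E g where x: "x = (E, g)" "finite E" "E \<subseteq> carrier G" "g \<in> carrier G"
    by (auto simp: lamplighter_def)
  then show "\<exists>y\<in>carrier (lamplighter G). y \<otimes>\<^bsub>lamplighter G\<^esub> x = \<one>\<^bsub>lamplighter G\<^esub>"
    by (intro bexI[of _ "(inv g <# E, inv g)"]) (auto simp: lamplighter_def l_coset_def)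
next
  fix x y
  assume "x \<in> carrier (lamplighter G)" "y \<in> carrier (lamplighter G)"
  then show "x \<otimes>\<^bsub>lamplighter G\<^esub> y \<in> carrier (lamplighter G)"
    by (auto simp: lamplighter_def l_coset_def)
next
  fix x y z
  assume "x \<in> carrier (lamplighter G)" "y \<in> carrier (lamplighter G)" "z \<in> carrier (lamplighter G)"
  then obtain E F K g h k where *: "x = (E, g)" "y = (F, h)" "z = (K, k)"
    "E \<subseteq> carrier G" "F \<subseteq> carrier G" "K \<subseteq> carrier G" 
    "g \<in> carrier G" "h \<in> carrier G" "k \<in> carrier G"
    by (auto simp: lamplighter_def)
  have img: "a <# B = (\<lambda>b. a \<otimes> b) ` B" for a B
    by (auto simp: l_coset_def)
  have inj: "inj_on (\<lambda>b. g \<otimes> b) (carrier G)"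
    using * by (intro inj_onI) auto
  have sub: "h <# K \<subseteq> carrier G"
    using * by (auto simp: img)
  have diff: "g <# (A - B) = (g <# A) - (g <# B)"
    if "A \<subseteq> carrier G" "B \<subseteq> carrier G" for A B
    unfolding img using inj that by (intro inj_on_image_set_diff) auto
  have "g <# (sym_diff F (h <# K)) = sym_diff (g <# F) (g <# (h <# K))"
    using * sub by (simp only: img[of g] image_Un flip: diff[unfolded img])
  moreover have "g <# (h <# K) = (g \<otimes> h) <# K"
    using * by (simp add: lcos_m_assoc)
  moreover have "sym_diff (sym_diff A B) C = sym_diff A (sym_diff B C)" for A B C :: "'a set"
    by blast
  ultimately show "x \<otimes>\<^bsub>lamplighter G\<^esub> y \<otimes>\<^bsub>lamplighter G\<^esub> z =
      x \<otimes>\<^bsub>lamplighter G\<^esub> (y \<otimes>\<^bsub>lamplighter G\<^esub> z)"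
    using * by (simp add: lamplighter_def m_assoc)
next
  show "\<one>\<^bsub>lamplighter G\<^esub> \<in> carrier (lamplighter G)"
    by (auto simp: lamplighter_def)
next
  fix x assume "x \<in> carrier (lamplighter G)"
  then show "\<one>\<^bsub>lamplighter G\<^esub> \<otimes>\<^bsub>lamplighter G\<^esub> x = x"
    by (auto simp: lamplighter_def lcos_mult_one)
qed

definition word_length :: "('a, 'b) monoid_scheme \<Rightarrow> 'a set \<Rightarrow> 'a \<Rightarrow> nat"
  where "word_length G S g =
    (LEAST n. \<exists>ws. length ws = n \<and> set ws \<subseteq> S \<and> foldr (\<otimes>\<^bsub>G\<^esub>) ws \<one>\<^bsub>G\<^esub> = g)"


section \<open>Operators on \<open>\<ell>\<^sup>2(X)\<close>\<close>

text \<open>Vectors of \<open>\<ell>\<^sup>2(X)\<close> are extended by \<open>0\<close> outside \<open>X\<close>; the operators in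
  \<open>bounded_operators X\<close> are extended by \<^const>\<open>undefined\<close> outside \<open>\<ell>\<^sup>2(X)\<close>, so that
  equality of HOL functions is equality of vectors and of operators.\<close>

definition ell2 :: "'a set \<Rightarrow> ('a \<Rightarrow> complex) set"
  where "ell2 X = {\<xi>. (\<forall>x. x \<notin> X \<longrightarrow> \<xi> x = 0) \<and> (\<lambda>x. (cmod (\<xi> x))\<^sup>2) summable_on X}"

definition ell2_inner :: "'a set \<Rightarrow> ('a \<Rightarrow> complex) \<Rightarrow> ('a \<Rightarrow> complex) \<Rightarrow> complex"
  where "ell2_inner X \<xi> \<eta> = (\<Sum>\<^sub>\<infinity>x\<in>X. \<xi> x * cnj (\<eta> x))"

definition ell2_norm :: "'a set \<Rightarrow> ('a \<Rightarrow> complex) \<Rightarrow> real"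
  where "ell2_norm X \<xi> = sqrt (\<Sum>\<^sub>\<infinity>x\<in>X. (cmod (\<xi> x))\<^sup>2)"

type_synonym 'a operator = "('a \<Rightarrow> complex) \<Rightarrow> ('a \<Rightarrow> complex)"

text \<open>The norm of an operator with domain \<open>V\<close>, with value \<open>\<infinity>\<close> if it is unbounded.\<close>

definition operator_norm :: "'a set \<Rightarrow> ('a \<Rightarrow> complex) set \<Rightarrow> 'a operator \<Rightarrow> ennreal"
  where "operator_norm X V T = (SUP \<xi>\<in>{\<xi>\<in>V. ell2_norm X \<xi> \<le> 1}. ennreal (ell2_norm X (T \<xi>)))"

definition bounded_operators :: "'a set \<Rightarrow> 'a operator set"
  where "bounded_operators X = {T \<in> ell2 X \<rightarrow>\<^sub>E ell2 X.
    (\<forall>\<xi>\<in>ell2 X. \<forall>\<eta>\<in>ell2 X. T (\<lambda>x. \<xi> x + \<eta> x) = (\<lambda>x. T \<xi> x + T \<eta> x)) \<and>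
    (\<forall>c. \<forall>\<xi>\<in>ell2 X. T (\<lambda>x. c * \<xi> x) = (\<lambda>x. c * T \<xi> x)) \<and>
    operator_norm X (ell2 X) T < \<infinity>}"

definition op_add :: "'a set \<Rightarrow> 'a operator \<Rightarrow> 'a operator \<Rightarrow> 'a operator"
  where "op_add X S T = (\<lambda>\<xi>\<in>ell2 X. \<lambda>x. S \<xi> x + T \<xi> x)"

definition op_scale :: "'a set \<Rightarrow> complex \<Rightarrow> 'a operator \<Rightarrow> 'a operator"
  where "op_scale X c T = (\<lambda>\<xi>\<in>ell2 X. \<lambda>x. c * T \<xi> x)"

definition op_id :: "'a set \<Rightarrow> 'a operator"
  where "op_id X = (\<lambda>\<xi>\<in>ell2 X. \<xi>)"

definition is_adjoint :: "'a set \<Rightarrow> 'a operator \<Rightarrow> 'a operator \<Rightarrow> bool"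
  where "is_adjoint X T T' \<longleftrightarrow>
    (\<forall>\<xi>\<in>ell2 X. \<forall>\<eta>\<in>ell2 X. ell2_inner X (T \<xi>) \<eta> = ell2_inner X \<xi> (T' \<eta>))"


section \<open>States and spectral metric spaces\<close>

text \<open>States of a unital C*-algebra \<open>A\<close> of bounded operators on \<open>\<ell>\<^sup>2(X)\<close>: normalised
  linear functionals that are nonnegative on all \<open>T\<^sup>* T\<close>.\<close>

definition states :: "'a set \<Rightarrow> 'a operator set \<Rightarrow> ('a operator \<Rightarrow> complex) set"
  where "states X A = {\<phi> \<in> extensional A.
    (\<forall>S\<in>A. \<forall>T\<in>A. \<phi> (op_add X S T) = \<phi> S + \<phi> T) \<and>
    (\<forall>c. \<forall>T\<in>A. \<phi> (op_scale X c T) = c * \<phi> T) \<and>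
    (\<forall>T\<in>A. \<forall>T'\<in>A. is_adjoint X T T' \<longrightarrow>
       \<phi> (compose (ell2 X) T' T) \<in> \<real> \<and> 0 \<le> Re (\<phi> (compose (ell2 X) T' T))) \<and>
    \<phi> (op_id X) = 1}"

definition weak_star_topology :: "'a set \<Rightarrow> 'a operator set \<Rightarrow> ('a operator \<Rightarrow> complex) topology"
  where "weak_star_topology X A = subtopology (product_topology (\<lambda>_. euclidean) A) (states X A)"

text \<open>An unbounded operator is a pair of its domain and its action on the domain; the
  commutator with \<open>T\<close> has its natural domain.\<close>

type_synonym 'a unbounded_operator = "('a \<Rightarrow> complex) set \<times> 'a operator"

definition commutator_norm :: "'a set \<Rightarrow> 'a unbounded_operator \<Rightarrow> 'a operator \<Rightarrow> ennreal"
  where "commutator_norm X D T =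
    operator_norm X {\<xi> \<in> fst D. T \<xi> \<in> fst D} (\<lambda>\<xi> x. snd D (T \<xi>) x - T (snd D \<xi>) x)"

definition spectral_dist ::
  "'a set \<Rightarrow> 'a operator set \<Rightarrow> 'a unbounded_operator
     \<Rightarrow> ('a operator \<Rightarrow> complex) \<Rightarrow> ('a operator \<Rightarrow> complex) \<Rightarrow> ennreal"
  where "spectral_dist X \<A> D \<phi> \<psi> =
    (SUP T\<in>{T\<in>\<A>. commutator_norm X D T \<le> 1}. ennreal (cmod (\<phi> T - \<psi> T)))"

definition ennreal_metric_topology :: "'a set \<Rightarrow> ('a \<Rightarrow> 'a \<Rightarrow> ennreal) \<Rightarrow> 'a topology"
  where "ennreal_metric_topology M d =
    topology (\<lambda>U. U \<subseteq> M \<and> (\<forall>x\<in>U. \<exists>e>0. \<forall>y\<in>M. d x y < e \<longrightarrow> y \<in> U))"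

lemma openin_ennreal_metric_topology:
  "openin (ennreal_metric_topology M d) U \<longleftrightarrow>
    U \<subseteq> M \<and> (\<forall>x\<in>U. \<exists>e>0. \<forall>y\<in>M. d x y < e \<longrightarrow> y \<in> U)"
proof -
  let ?P = "\<lambda>U x. \<exists>e>0. \<forall>y\<in>M. d x y < e \<longrightarrow> y \<in> U"
  have Int: "?P (U \<inter> V) x" if U: "?P U x" and V: "?P V x" for U V x
  proof -
    from U obtain e where e: "e > 0" "\<forall>y\<in>M. d x y < e \<longrightarrow> y \<in> U" by (elim exE conjE)
    from V obtain e' where e': "e' > 0" "\<forall>y\<in>M. d x y < e' \<longrightarrow> y \<in> V" by (elim exE conjE)
    have "\<forall>y\<in>M. d x y < min e e' \<longrightarrow> y \<in> U \<inter> V"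
      using e(2) e'(2) by (simp only: min_less_iff_conj Int_iff) fast
    moreover have "min e e' > 0"
      using e(1) e'(1) by (simp only: min_less_iff_conj)
    ultimately show ?thesis by (intro exI conjI)
  qed
  have "istopology (\<lambda>U. U \<subseteq> M \<and> (\<forall>x\<in>U. ?P U x))"
    unfolding istopology_def
  proof (rule conjI)
    show "\<forall>U V. U \<subseteq> M \<and> (\<forall>x\<in>U. ?P U x) \<longrightarrow> V \<subseteq> M \<and> (\<forall>x\<in>V. ?P V x) \<longrightarrow>
      U \<inter> V \<subseteq> M \<and> (\<forall>x\<in>U \<inter> V. ?P (U \<inter> V) x)"
    proof (intro allI impI conjI ballI)
      fix U V x
      assume U: "U \<subseteq> M \<and> (\<forall>x\<in>U. ?P U x)" and V: "V \<subseteq> M \<and> (\<forall>x\<in>V. ?P V x)"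
        and x: "x \<in> U \<inter> V"
      show "?P (U \<inter> V) x"
        by (rule Int[OF bspec[OF conjunct2[OF U] IntD1[OF x]] bspec[OF conjunct2[OF V] IntD2[OF x]]])
    qed fast
    show "\<forall>\<K>. (\<forall>K\<in>\<K>. K \<subseteq> M \<and> (\<forall>x\<in>K. ?P K x)) \<longrightarrow>
      \<Union>\<K> \<subseteq> M \<and> (\<forall>x\<in>\<Union>\<K>. ?P (\<Union>\<K>) x)"
    proof (intro allI impI conjI ballI)
      fix \<K> x
      assume *: "\<forall>K\<in>\<K>. K \<subseteq> M \<and> (\<forall>x\<in>K. ?P K x)" and "x \<in> \<Union>\<K>"
      then obtain K where K: "K \<in> \<K>" "x \<in> K" by (elim UnionE)
      from bspec[OF conjunct2[OF bspec[OF * K(1)]] K(2)]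
      obtain e where e: "e > 0" "\<forall>y\<in>M. d x y < e \<longrightarrow> y \<in> K" by (elim exE conjE)
      have "\<forall>y\<in>M. d x y < e \<longrightarrow> y \<in> \<Union>\<K>"
        using e(2) K(1) by fast
      with e(1) show "?P (\<Union>\<K>) x" by (intro exI conjI)
    qed fast
  qed
  from topology_inverse'[OF this] show ?thesis
    unfolding ennreal_metric_topology_def by (rule fun_cong)
qed

text \<open>The triple \<open>(\<A>, \<ell>\<^sup>2(X), D)\<close> over \<open>A\<close>, where \<open>A\<close> acts on \<open>\<ell>\<^sup>2(X)\<close> by the
  identity representation. This is meant to be used for non-degenerate spectral triples only;
  these axioms are not part of the predicate, so its negation asserts that the two
  topologies really differ.\<close>

definition spectral_metric_space ::
  "'a set \<Rightarrow> 'a operator set \<Rightarrow> 'a operator set \<Rightarrow> 'a unbounded_operator \<Rightarrow> bool"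
  where "spectral_metric_space X A \<A> D \<longleftrightarrow>
    ennreal_metric_topology (states X A) (spectral_dist X \<A> D) = weak_star_topology X A"


section \<open>Group C*-algebras and length operators\<close>

definition left_regular :: "('a, 'b) monoid_scheme \<Rightarrow> 'a \<Rightarrow> 'a operator"
  where "left_regular G g = (\<lambda>\<xi>\<in>ell2 (carrier G). \<lambda>h.
    if h \<in> carrier G then \<xi> (inv\<^bsub>G\<^esub> g \<otimes>\<^bsub>G\<^esub> h) else 0)"

definition group_algebra :: "('a, 'b) monoid_scheme \<Rightarrow> 'a operator set"
  where "group_algebra G =
    {(\<lambda>\<xi>\<in>ell2 (carrier G). \<lambda>h. \<Sum>g\<in>F. c g * left_regular G g \<xi> h) | F c.
      finite F \<and> F \<subseteq> carrier G}"

definition reduced_group_cstar_algebra :: "('a, 'b) monoid_scheme \<Rightarrow> 'a operator set"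
  where "reduced_group_cstar_algebra G = {T \<in> bounded_operators (carrier G).
    \<forall>e>0. \<exists>S\<in>group_algebra G.
      operator_norm (carrier G) (ell2 (carrier G)) (\<lambda>\<xi> x. T \<xi> x - S \<xi> x) < e}"

text \<open>The self-adjoint operator \<open>D\<^sub>\<ell>\<close> with \<open>D\<^sub>\<ell> \<delta>\<^sub>g = \<ell>(g) \<delta>\<^sub>g\<close> is multiplication by \<open>\<ell>\<close>
  with its maximal domain.\<close>

definition length_operator :: "('a, 'b) monoid_scheme \<Rightarrow> ('a \<Rightarrow> nat) \<Rightarrow> 'a unbounded_operator"
  where "length_operator G L =
    ({\<xi> \<in> ell2 (carrier G). (\<lambda>g. of_nat (L g) * \<xi> g) \<in> ell2 (carrier G)},
     \<lambda>\<xi> g. of_nat (L g) * \<xi> g)"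

lemma length_operator_delta:
  assumes "g \<in> carrier G"
  defines "\<delta> \<equiv> (\<lambda>h. of_bool (h = g))"
  shows "\<delta> \<in> fst (length_operator G L)"
    and "snd (length_operator G L) \<delta> = (\<lambda>h. of_nat (L g) * \<delta> h)"
proof -
  have "(\<lambda>h. c * \<delta> h) \<in> ell2 (carrier G)" for c
  proof -
    have "(\<lambda>h. (cmod (c * \<delta> h))\<^sup>2) summable_on carrier G \<longleftrightarrow>
          (\<lambda>h. (cmod (c * \<delta> h))\<^sup>2) summable_on {g}"
      using assms(1) by (intro summable_on_cong_neutral) (auto simp: \<delta>_def)
    then show ?thesis
      using assms(1) by (auto simp: ell2_def \<delta>_def)
  qed
  note this[of 1] this[of "of_nat (L g)"]
  moreover show eq: "snd (length_operator G L) \<delta> = (\<lambda>h. of_nat (L g) * \<delta> h)"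
    by (auto simp: length_operator_def \<delta>_def)
  ultimately show "\<delta> \<in> fst (length_operator G L)"
    by (simp add: length_operator_def)
qed

text \<open>The graph of the adjoint equals the graph of the operator. In particular the domain is
  dense, as seen from \<open>\<eta> = 0\<close>.\<close>

lemma length_operator_selfadjoint:
  fixes L :: "'a \<Rightarrow> nat"
  assumes "\<eta> \<in> ell2 (carrier G)" "\<zeta> \<in> ell2 (carrier G)"
  defines "D \<equiv> length_operator G L"
  shows "(\<forall>\<xi>\<in>fst D. ell2_inner (carrier G) (snd D \<xi>) \<eta> = ell2_inner (carrier G) \<xi> \<zeta>)
    \<longleftrightarrow> \<eta> \<in> fst D \<and> snd D \<eta> = \<zeta>" (is "?lhs \<longleftrightarrow> ?rhs")
proof
  assume ?rhs
  then have "\<zeta> = (\<lambda>g. of_nat (L g) * \<eta> g)"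
    by (simp add: D_def length_operator_def)
  then show ?lhs
    by (simp add: D_def length_operator_def ell2_inner_def mult_ac)
next
  assume lhs: ?lhs
  have inner: "ell2_inner (carrier G) (\<lambda>h. c * of_bool (h = g)) \<theta> = c * cnj (\<theta> g)"
    if "g \<in> carrier G" for g c \<theta>
  proof -
    have "ell2_inner (carrier G) (\<lambda>h. c * of_bool (h = g)) \<theta> =
          (\<Sum>\<^sub>\<infinity>h\<in>{g}. c * of_bool (h = g) * cnj (\<theta> h))"
      unfolding ell2_inner_def using that by (intro infsum_cong_neutral) simp_all
    then show ?thesis by simp
  qed
  have "\<zeta> g = of_nat (L g) * \<eta> g" for g
  proof (cases "g \<in> carrier G")
    case True
    have "ell2_inner (carrier G) (\<lambda>h. of_nat (L g) * of_bool (h = g)) \<eta> =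
          ell2_inner (carrier G) (\<lambda>h. 1 * of_bool (h = g)) \<zeta>"
      using bspec[OF lhs, of "\<lambda>h. of_bool (h = g)"] length_operator_delta[OF True, of L]
      unfolding D_def mult_1 by (simp only:)
    then have "of_nat (L g) * cnj (\<eta> g) = cnj (\<zeta> g)"
      unfolding inner[OF True] by (simp only: mult_1)
    then have "cnj (of_nat (L g) * \<eta> g) = cnj (\<zeta> g)"
      by simp
    then show ?thesis
      by (simp only: complex_cnj_cancel_iff)
  next
    case False
    then show ?thesis
      using assms(1,2) by (simp add: ell2_def)
  qed
  then have "\<zeta> = (\<lambda>g. of_nat (L g) * \<eta> g)" by (rule ext)
  then show ?rhs
    using assms(1,2) by (simp add: D_def length_operator_def)
qed

end

theory Submission
  imports Defs
begin

text \<open>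
  Let \<open>T\<close> be the set of the \<open>2 ^ n\<close> positive words of length \<open>n\<close> in two of the free generators and
  let \<open>a\<^sub>n\<close> be the average of the single-lamp elements \<open>({t}, 1)\<close> over \<open>t \<in> T\<close>. Switching the
  lamp \<open>t\<close> at \<open>(E, g)\<close> changes the word length by at most a constant times the number of edges
  on the branch towards \<open>t\<close> beyond which no other lamp in \<open>E \<inter> T\<close> is lit. The operator contributed
  by such an edge at level \<open>k\<close> has norm of order \<open>2 powr ((n - k) / 2) / 2 ^ n\<close>, and there are
  \<open>2 ^ k\<close> edges, so the sum over all edges is a geometric series: exponential growth of the tree makes
  the commutators \<open>[D, a\<^sub>n]\<close> uniformly bounded.

  On the other hand, let \<open>H\<^sub>n\<close> be the finite group of all lamp configurations supported in \<open>T\<close>.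
  The vector states of the normalised indicator functions of \<open>H\<^sub>n\<close> converge weakly-* to the
  canonical trace, because every nontrivial group element lies in at most one \<open>H\<^sub>n\<close>. But they take
  the value \<open>1\<close> on \<open>a\<^sub>n\<close>, where the trace vanishes, so they stay at a fixed distance from it.
\<close>

section \<open>Vectors and bounded operators on \<open>\<ell>\<^sup>2(X)\<close>\<close>

lemma L2_set_le_ell2_norm:
  assumes "\<xi> \<in> ell2 X" "finite F" "F \<subseteq> X"
  shows "L2_set (\<lambda>x. cmod (\<xi> x)) F \<le> ell2_norm X \<xi>"
  unfolding L2_set_def ell2_norm_def
  using assms by (intro real_sqrt_le_mono finite_sum_le_infsum) (auto simp: ell2_def)

text \<open>Sums of nonnegative terms are controlled by their finite partial sums. This lets
  membership in \<open>ell2 X\<close> and norm bounds be derived from inequalities for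
  \<open>L2_set\<close> on finite sets, such as Minkowski's.\<close>

lemma ell2_bounded_finite:
  assumes "\<And>x. x \<notin> X \<Longrightarrow> \<xi> x = 0"
    and "\<And>F. finite F \<Longrightarrow> F \<subseteq> X \<Longrightarrow> L2_set (\<lambda>x. cmod (\<xi> x)) F \<le> B"
  shows "\<xi> \<in> ell2 X" "ell2_norm X \<xi> \<le> B"
proof -
  have B: "B \<ge> 0"
    using assms(2)[of "{}"] by simp
  have le: "(\<Sum>x\<in>F. (cmod (\<xi> x))\<^sup>2) \<le> B\<^sup>2" if "finite F" "F \<subseteq> X" for F
    using assms(2)[OF that] unfolding L2_set_def by (rule sqrt_le_D)
  have sum: "(\<lambda>x. (cmod (\<xi> x))\<^sup>2) summable_on X"
    by (rule nonneg_bdd_above_summable_on) (auto intro!: bdd_aboveI[of _ "B\<^sup>2"] le)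
  then show "\<xi> \<in> ell2 X"
    using assms(1) by (auto simp: ell2_def)
  have "(\<Sum>\<^sub>\<infinity>x\<in>X. (cmod (\<xi> x))\<^sup>2) \<le> B\<^sup>2"
    by (rule infsum_le_finite_sums[OF sum le])
  then show "ell2_norm X \<xi> \<le> B"
    unfolding ell2_norm_def using B by (rule real_le_lsqrt[rotated -1])
qed

lemma ell2_zero_outside: "\<xi> \<in> ell2 X \<Longrightarrow> x \<notin> X \<Longrightarrow> \<xi> x = 0"
  by (auto simp: ell2_def)

lemma ell2_norm_nonneg [simp]: "0 \<le> ell2_norm X \<xi>"
  by (simp add: ell2_norm_def infsum_nonneg)

lemma ell2_add:
  assumes "\<xi> \<in> ell2 X" "\<eta> \<in> ell2 X"
  shows "(\<lambda>x. \<xi> x + \<eta> x) \<in> ell2 X"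
    and "ell2_norm X (\<lambda>x. \<xi> x + \<eta> x) \<le> ell2_norm X \<xi> + ell2_norm X \<eta>"
proof -
  have "L2_set (\<lambda>x. cmod (\<xi> x + \<eta> x)) F \<le> ell2_norm X \<xi> + ell2_norm X \<eta>"
    if F: "finite F" "F \<subseteq> X" for F
  proof -
    have "L2_set (\<lambda>x. cmod (\<xi> x + \<eta> x)) F \<le> L2_set (\<lambda>x. cmod (\<xi> x) + cmod (\<eta> x)) F"
      by (intro L2_set_mono norm_triangle_ineq) auto
    also have "\<dots> \<le> L2_set (\<lambda>x. cmod (\<xi> x)) F + L2_set (\<lambda>x. cmod (\<eta> x)) F"
      by (rule L2_set_triangle_ineq)
    finally show ?thesis
      using L2_set_le_ell2_norm[OF assms(1) F] L2_set_le_ell2_norm[OF assms(2) F] by linarith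
  qed
  note * = ell2_bounded_finite[where \<xi> = "\<lambda>x. \<xi> x + \<eta> x", OF _ this]
  show "(\<lambda>x. \<xi> x + \<eta> x) \<in> ell2 X"
    and "ell2_norm X (\<lambda>x. \<xi> x + \<eta> x) \<le> ell2_norm X \<xi> + ell2_norm X \<eta>"
    using assms by (auto intro!: * simp: ell2_zero_outside)
qed

lemma ell2_norm_scale: "ell2_norm X (\<lambda>x. c * \<xi> x) = cmod c * ell2_norm X \<xi>"
  by (simp add: ell2_norm_def norm_mult power_mult_distrib infsum_cmult_right' real_sqrt_mult)

lemma ell2_scale: "\<xi> \<in> ell2 X \<Longrightarrow> (\<lambda>x. c * \<xi> x) \<in> ell2 X"
  by (auto simp: ell2_def norm_mult power_mult_distrib intro: summable_on_cmult_right)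

lemma ell2_diff:
  assumes "\<xi> \<in> ell2 X" "\<eta> \<in> ell2 X"
  shows "(\<lambda>x. \<xi> x - \<eta> x) \<in> ell2 X"
  using ell2_add(1)[OF assms(1) ell2_scale[OF assms(2), of "-1"]] by simp

lemma ell2_zero: "(\<lambda>x. 0) \<in> ell2 X"
  by (simp add: ell2_def)

lemma ell2_norm_eq_0:
  assumes "\<xi> \<in> ell2 X" "ell2_norm X \<xi> = 0"
  shows "\<xi> = (\<lambda>x. 0)"
proof
  fix x
  show "\<xi> x = 0"
    using L2_set_le_ell2_norm[OF assms(1), of "{x}"] assms
    by (cases "x \<in> X") (auto simp: ell2_zero_outside)
qed

lemma ell2_finite_support:
  assumes "finite H" "H \<subseteq> X" "\<And>x. x \<notin> H \<Longrightarrow> \<xi> x = 0"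
  shows "\<xi> \<in> ell2 X" "ell2_norm X \<xi> = L2_set (\<lambda>x. cmod (\<xi> x)) H"
proof -
  have "(\<lambda>x. (cmod (\<xi> x))\<^sup>2) summable_on X \<longleftrightarrow> (\<lambda>x. (cmod (\<xi> x))\<^sup>2) summable_on H"
    using assms by (intro summable_on_cong_neutral) auto
  then show "\<xi> \<in> ell2 X"
    using assms by (auto simp: ell2_def)
  have "(\<Sum>\<^sub>\<infinity>x\<in>X. (cmod (\<xi> x))\<^sup>2) = (\<Sum>\<^sub>\<infinity>x\<in>H. (cmod (\<xi> x))\<^sup>2)"
    using assms by (intro infsum_cong_neutral) auto
  then show "ell2_norm X \<xi> = L2_set (\<lambda>x. cmod (\<xi> x)) H"
    using assms(1) by (simp add: ell2_norm_def L2_set_def)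
qed

lemma ell2_inner_finite_support:
  assumes "finite H" "H \<subseteq> X" "\<And>x. x \<notin> H \<Longrightarrow> \<eta> x = 0"
  shows "ell2_inner X \<xi> \<eta> = (\<Sum>x\<in>H. \<xi> x * cnj (\<eta> x))"
proof -
  have "(\<Sum>\<^sub>\<infinity>x\<in>X. \<xi> x * cnj (\<eta> x)) = (\<Sum>\<^sub>\<infinity>x\<in>H. \<xi> x * cnj (\<eta> x))"
    using assms by (intro infsum_cong_neutral) auto
  then show ?thesis
    using assms(1) by (simp add: ell2_inner_def)
qed

text \<open>Cauchy-Schwarz. The finite support of \<open>\<eta>\<close> reduces it to a finite sum;
  the vectors defining the states below are all of this kind.\<close>

lemma cmod_ell2_inner_finite_support:
  assumes "finite H" "H \<subseteq> X" "\<And>x. x \<notin> H \<Longrightarrow> \<eta> x = 0" "\<xi> \<in> ell2 X"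
  shows "cmod (ell2_inner X \<xi> \<eta>) \<le> ell2_norm X \<xi> * ell2_norm X \<eta>"
proof -
  have "ell2_inner X \<xi> \<eta> = (\<Sum>x\<in>H. \<xi> x * cnj (\<eta> x))"
    by (rule ell2_inner_finite_support) (use assms in auto)
  then have "cmod (ell2_inner X \<xi> \<eta>) \<le> (\<Sum>x\<in>H. \<bar>cmod (\<xi> x)\<bar> * \<bar>cmod (\<eta> x)\<bar>)"
    using norm_sum[of "\<lambda>x. \<xi> x * cnj (\<eta> x)" H] by (simp add: norm_mult)
  also have "\<dots> \<le> L2_set (\<lambda>x. cmod (\<xi> x)) H * L2_set (\<lambda>x. cmod (\<eta> x)) H"
    by (rule L2_set_mult_ineq)
  also have "\<dots> \<le> ell2_norm X \<xi> * ell2_norm X \<eta>"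
    using ell2_finite_support(2)[of H X \<eta>] assms
    by (simp add: mult_right_mono L2_set_le_ell2_norm)
  finally show ?thesis .
qed

lemma ell2_inner_cnj: "ell2_inner X \<xi> \<eta> = cnj (ell2_inner X \<eta> \<xi>)"
  by (simp add: ell2_inner_def mult.commute flip: infsum_cnj)

lemma ell2_inner_self:
  assumes "\<xi> \<in> ell2 X"
  shows "ell2_inner X \<xi> \<xi> = of_real ((ell2_norm X \<xi>)\<^sup>2)"
proof -
  have "ell2_inner X \<xi> \<xi> = (\<Sum>\<^sub>\<infinity>x\<in>X. of_real ((cmod (\<xi> x))\<^sup>2))"
    unfolding ell2_inner_def by (simp only: complex_norm_square)
  also have "\<dots> = of_real (\<Sum>\<^sub>\<infinity>x\<in>X. (cmod (\<xi> x))\<^sup>2)"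
  proof (rule infsum_bounded_linear_strong[OF _ bounded_linear_of_real])
    have "(\<lambda>x. (cmod (\<xi> x))\<^sup>2) summable_on X"
      using assms by (simp add: ell2_def)
    then show "(\<lambda>x. complex_of_real ((cmod (\<xi> x))\<^sup>2)) summable_on X \<longleftrightarrow>
        (\<lambda>x. (cmod (\<xi> x))\<^sup>2) summable_on X"
      using summable_on_of_real[of "\<lambda>x. (cmod (\<xi> x))\<^sup>2" X] by blast
  qed
  finally show ?thesis
    by (simp add: ell2_norm_def infsum_nonneg)
qed

text \<open>The Schur test, with the Cauchy-Schwarz weights \<open>v i\<close> inverted by the involutions \<open>b i\<close>.\<close>

lemma schur_test:
  assumes "finite I"
    and b: "\<And>i x. i \<in> I \<Longrightarrow> x \<in> X \<Longrightarrow> b i x \<in> X"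
    and bb: "\<And>i x. i \<in> I \<Longrightarrow> x \<in> X \<Longrightarrow> b i (b i x) = x"
    and \<kappa>: "\<And>i x. i \<in> I \<Longrightarrow> x \<in> X \<Longrightarrow> 0 \<le> \<kappa> i x"
    and \<kappa>b: "\<And>i x. i \<in> I \<Longrightarrow> x \<in> X \<Longrightarrow> \<kappa> i (b i x) = \<kappa> i x"
    and v: "\<And>i x. i \<in> I \<Longrightarrow> x \<in> X \<Longrightarrow> 0 < v i x"
    and vb: "\<And>i x. i \<in> I \<Longrightarrow> x \<in> X \<Longrightarrow> v i x * v i (b i x) = 1"
    and C: "\<And>x. x \<in> X \<Longrightarrow> (\<Sum>i\<in>I. \<kappa> i x * v i x) \<le> C"
    and "0 \<le> C" and \<xi>: "\<xi> \<in> ell2 X" and \<eta>0: "\<And>x. x \<notin> X \<Longrightarrow> \<eta> x = 0"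
    and \<eta>: "\<And>x. x \<in> X \<Longrightarrow> cmod (\<eta> x) \<le> (\<Sum>i\<in>I. \<kappa> i x * cmod (\<xi> (b i x)))"
  shows "ell2_norm X \<eta> \<le> C * ell2_norm X \<xi>"
proof (rule ell2_bounded_finite(2)[OF \<eta>0])
  fix F assume F: "finite F" "F \<subseteq> X"
  \<comment> \<open>Cauchy-Schwarz will separate the weight \<open>\<kappa> i x * v i x\<close> from
    \<open>f i (b i x)\<close>. In terms of \<open>y = b i x\<close> the latter again carries the
    weight \<open>\<kappa> i y * v i y\<close>, because \<open>v i\<close> is inverted by
    \<open>b i\<close>. So assumption \<open>C\<close> bounds both the row sums and the column
    sums.\<close>
  define f where "f = (\<lambda>i y. \<kappa> i y * v i y * (cmod (\<xi> y))\<^sup>2)"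
  define F' where "F' = (\<Union>i\<in>I. b i ` F)"
  have F': "finite F'" "F' \<subseteq> X"
    using F b \<open>finite I\<close> by (auto simp: F'_def)
  have f_nonneg: "0 \<le> f i y" if "i \<in> I" "y \<in> X" for i y
    using \<kappa>[OF that] v[OF that] by (simp add: f_def)
  have pointwise: "(cmod (\<eta> x))\<^sup>2 \<le> C * (\<Sum>i\<in>I. f i (b i x))" if x: "x \<in> X" for x
  proof -
    have "(cmod (\<eta> x))\<^sup>2 \<le> (\<Sum>i\<in>I. \<kappa> i x * cmod (\<xi> (b i x)))\<^sup>2"
      using \<eta>[OF x] by (intro power_mono) auto
    also have "\<dots> = (\<Sum>i\<in>I. sqrt (\<kappa> i x * v i x) * sqrt (f i (b i x)))\<^sup>2"
    proof (intro arg_cong[where f = power2] sum.cong refl)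
      fix i assume i: "i \<in> I"
      have "\<kappa> i x * v i x * f i (b i x) = (\<kappa> i x)\<^sup>2 * (v i x * v i (b i x)) * (cmod (\<xi> (b i x)))\<^sup>2"
        by (simp add: f_def \<kappa>b[OF i x] power2_eq_square)
      also have "\<dots> = (\<kappa> i x * cmod (\<xi> (b i x)))\<^sup>2"
        by (simp add: vb[OF i x] power_mult_distrib)
      finally show "\<kappa> i x * cmod (\<xi> (b i x)) = sqrt (\<kappa> i x * v i x) * sqrt (f i (b i x))"
        using \<kappa>[OF i x] by (simp flip: real_sqrt_mult)
    qed
    also have "\<dots> \<le> (\<Sum>i\<in>I. (sqrt (\<kappa> i x * v i x))\<^sup>2) * (\<Sum>i\<in>I. (sqrt (f i (b i x)))\<^sup>2)"
      by (rule Cauchy_Schwarz_ineq_sum)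
    also have "\<dots> = (\<Sum>i\<in>I. \<kappa> i x * v i x) * (\<Sum>i\<in>I. f i (b i x))"
      using \<kappa> v f_nonneg b x by (simp add: less_imp_le)
    also have "\<dots> \<le> C * (\<Sum>i\<in>I. f i (b i x))"
      using C x f_nonneg b by (intro mult_right_mono sum_nonneg) auto
    finally show ?thesis .
  qed
  have "(\<Sum>x\<in>F. (cmod (\<eta> x))\<^sup>2) \<le> (\<Sum>x\<in>F. C * (\<Sum>i\<in>I. f i (b i x)))"
    using F by (intro sum_mono pointwise) auto
  also have "\<dots> = C * (\<Sum>i\<in>I. \<Sum>x\<in>F. f i (b i x))"
    by (simp add: sum_distrib_left) (rule sum.swap)
  also have "\<dots> \<le> C * (\<Sum>i\<in>I. \<Sum>y\<in>F'. f i y)"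
  proof (intro mult_left_mono sum_mono \<open>0 \<le> C\<close>)
    fix i assume i: "i \<in> I"
    have "inj_on (b i) F"
      using bb[OF i] F by (intro inj_on_inverseI[of _ "b i"]) auto
    then have "(\<Sum>x\<in>F. f i (b i x)) = (\<Sum>y\<in>b i ` F. f i y)"
      by (simp add: sum.reindex)
    also have "\<dots> \<le> (\<Sum>y\<in>F'. f i y)"
      using i F' f_nonneg by (intro sum_mono2) (auto simp: F'_def)
    finally show "(\<Sum>x\<in>F. f i (b i x)) \<le> (\<Sum>y\<in>F'. f i y)" .
  qed
  also have "\<dots> = C * (\<Sum>y\<in>F'. (\<Sum>i\<in>I. \<kappa> i y * v i y) * (cmod (\<xi> y))\<^sup>2)"
    by (simp add: f_def sum_distrib_right sum.swap[of _ F' I])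
  also have "\<dots> \<le> C * (\<Sum>y\<in>F'. C * (cmod (\<xi> y))\<^sup>2)"
    using C F' \<open>0 \<le> C\<close> by (intro mult_left_mono sum_mono mult_right_mono) auto
  also have "\<dots> = (C * L2_set (\<lambda>x. cmod (\<xi> x)) F')\<^sup>2"
    by (simp add: power_mult_distrib L2_set_def sum_nonneg flip: sum_distrib_left) (simp add: power2_eq_square)
  also have "\<dots> \<le> (C * ell2_norm X \<xi>)\<^sup>2"
    using L2_set_le_ell2_norm[OF \<xi> F'] \<open>0 \<le> C\<close>
    by (intro power_mono mult_left_mono) (auto simp: L2_set_nonneg)
  finally show "L2_set (\<lambda>x. cmod (\<eta> x)) F \<le> C * ell2_norm X \<xi>"
    unfolding L2_set_def using \<open>0 \<le> C\<close> by (intro real_le_lsqrt) (auto intro: sum_nonneg)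
qed

section \<open>Operator norms and the algebra of bounded operators\<close>

lemma operator_norm_le:
  assumes "\<And>\<xi>. \<xi> \<in> V \<Longrightarrow> ell2_norm X (T \<xi>) \<le> B * ell2_norm X \<xi>" "0 \<le> B"
  shows "operator_norm X V T \<le> ennreal B"
  unfolding operator_norm_def
proof (rule SUP_least)
  fix \<xi> assume "\<xi> \<in> {\<xi> \<in> V. ell2_norm X \<xi> \<le> 1}"
  then have "ell2_norm X (T \<xi>) \<le> B * ell2_norm X \<xi>" "ell2_norm X \<xi> \<le> 1"
    using assms(1) by auto
  then show "ennreal (ell2_norm X (T \<xi>)) \<le> ennreal B"
    using mult_left_le[of "ell2_norm X \<xi>" B] assms(2) by (intro ennreal_leI) linarith
qed

text \<open>A vector of nonzero norm is rescaled into the unit ball; a vector of norm zero is the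
  zero vector, which homogeneity sends to zero. The form for homogeneous maps covers the plain
  pointwise difference of two operators, which is not cut off outside \<open>ell2 X\<close>.\<close>

lemma operator_norm_bound:
  assumes "\<And>c \<xi>. \<xi> \<in> ell2 X \<Longrightarrow> T (\<lambda>x. c * \<xi> x) = (\<lambda>x. c * T \<xi> x)"
    and "operator_norm X (ell2 X) T \<le> ennreal B" "0 \<le> B" and \<xi>: "\<xi> \<in> ell2 X"
  shows "ell2_norm X (T \<xi>) \<le> B * ell2_norm X \<xi>"
proof (cases "ell2_norm X \<xi> = 0")
  case True
  then have "\<xi> = (\<lambda>x. 0 * \<xi> x)"
    using ell2_norm_eq_0[OF \<xi>] by simp
  then have "T \<xi> = (\<lambda>x. 0 * T \<xi> x)"
    using assms(1)[OF \<xi>, of 0] by metis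
  then have "ell2_norm X (T \<xi>) = 0"
    using ell2_norm_scale[of X 0 "T \<xi>"] by simp
  then show ?thesis
    using True by simp
next
  case False
  define c where "c = complex_of_real (1 / ell2_norm X \<xi>)"
  have pos: "ell2_norm X \<xi> > 0"
    using False by (simp add: less_le)
  have c: "cmod c = 1 / ell2_norm X \<xi>"
    unfolding c_def norm_of_real using pos by simp
  have "ell2_norm X (\<lambda>x. c * \<xi> x) \<le> 1"
    using pos by (simp add: ell2_norm_scale c)
  then have "ennreal (ell2_norm X (T (\<lambda>x. c * \<xi> x))) \<le> operator_norm X (ell2 X) T"
    unfolding operator_norm_def using ell2_scale[OF \<xi>] by (intro SUP_upper) auto
  with assms(2) have "ell2_norm X (T (\<lambda>x. c * \<xi> x)) \<le> B"
    using assms(3) by (metis ennreal_le_iff order_trans)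
  then have "1 / ell2_norm X \<xi> * ell2_norm X (T \<xi>) \<le> B"
    by (simp add: assms(1)[OF \<xi>] ell2_norm_scale c)
  then show ?thesis
    using pos by (simp add: field_simps)
qed

lemma bounded_operatorsI:
  assumes "T \<in> extensional (ell2 X)"
    and "\<And>\<xi>. \<xi> \<in> ell2 X \<Longrightarrow> T \<xi> \<in> ell2 X"
    and "\<And>\<xi> \<eta>. \<xi> \<in> ell2 X \<Longrightarrow> \<eta> \<in> ell2 X \<Longrightarrow> T (\<lambda>x. \<xi> x + \<eta> x) = (\<lambda>x. T \<xi> x + T \<eta> x)"
    and "\<And>c \<xi>. \<xi> \<in> ell2 X \<Longrightarrow> T (\<lambda>x. c * \<xi> x) = (\<lambda>x. c * T \<xi> x)"
    and "\<And>\<xi>. \<xi> \<in> ell2 X \<Longrightarrow> ell2_norm X (T \<xi>) \<le> B * ell2_norm X \<xi>" "0 \<le> B"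
  shows "T \<in> bounded_operators X"
  using assms(1-4) operator_norm_le[of "ell2 X" X T B, OF assms(5,6)]
  by (auto simp: bounded_operators_def PiE_def le_less_trans)

lemma bounded_operatorsD:
  assumes "T \<in> bounded_operators X" "\<xi> \<in> ell2 X"
  shows "T \<xi> \<in> ell2 X"
    and "\<eta> \<in> ell2 X \<Longrightarrow> T (\<lambda>x. \<xi> x + \<eta> x) = (\<lambda>x. T \<xi> x + T \<eta> x)"
    and "T (\<lambda>x. c * \<xi> x) = (\<lambda>x. c * T \<xi> x)"
  using assms by (auto simp: bounded_operators_def)

lemma bounded_operators_diff:
  assumes "T \<in> bounded_operators X" "\<xi> \<in> ell2 X" "\<eta> \<in> ell2 X"
  shows "T (\<lambda>x. \<xi> x - \<eta> x) = (\<lambda>x. T \<xi> x - T \<eta> x)"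
  using bounded_operatorsD(2)[OF assms(1,2) ell2_scale[OF assms(3), of "-1"]]
    bounded_operatorsD(3)[OF assms(1,3), of "-1"] by simp

lemma bounded_operators_bound:
  assumes "T \<in> bounded_operators X"
  obtains B where "0 \<le> B" "\<And>\<xi>. \<xi> \<in> ell2 X \<Longrightarrow> ell2_norm X (T \<xi>) \<le> B * ell2_norm X \<xi>"
proof
  let ?B = "enn2real (operator_norm X (ell2 X) T)"
  show "0 \<le> ?B"
    by simp
  have "operator_norm X (ell2 X) T \<le> ennreal ?B"
    using assms by (simp add: bounded_operators_def)
  then show "\<xi> \<in> ell2 X \<Longrightarrow> ell2_norm X (T \<xi>) \<le> ?B * ell2_norm X \<xi>" for \<xi>
    using assms by (intro operator_norm_bound) (auto simp: bounded_operators_def)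
qed

lemma op_add_bounded:
  assumes S: "S \<in> bounded_operators X" and T: "T \<in> bounded_operators X"
  shows "op_add X S T \<in> bounded_operators X"
proof -
  obtain B C where *: "0 \<le> B" "\<And>\<xi>. \<xi> \<in> ell2 X \<Longrightarrow> ell2_norm X (S \<xi>) \<le> B * ell2_norm X \<xi>"
    "0 \<le> C" "\<And>\<xi>. \<xi> \<in> ell2 X \<Longrightarrow> ell2_norm X (T \<xi>) \<le> C * ell2_norm X \<xi>"
    using bounded_operators_bound S T by metis
  show ?thesis
  proof (rule bounded_operatorsI[where B = "B + C"])
    fix \<xi> assume \<xi>: "\<xi> \<in> ell2 X"
    show "ell2_norm X (op_add X S T \<xi>) \<le> (B + C) * ell2_norm X \<xi>"
      using ell2_add(2)[OF bounded_operatorsD(1)[OF S \<xi>] bounded_operatorsD(1)[OF T \<xi>]]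
        *(2,4)[OF \<xi>] \<xi> by (simp add: op_add_def distrib_right)
  qed (use * in \<open>auto simp: op_add_def bounded_operatorsD[OF S] bounded_operatorsD[OF T]
      ell2_add ell2_scale algebra_simps\<close>)
qed

lemma op_scale_bounded:
  assumes T: "T \<in> bounded_operators X"
  shows "op_scale X c T \<in> bounded_operators X"
proof -
  obtain B where *: "0 \<le> B" "\<And>\<xi>. \<xi> \<in> ell2 X \<Longrightarrow> ell2_norm X (T \<xi>) \<le> B * ell2_norm X \<xi>"
    using bounded_operators_bound T by metis
  show ?thesis
  proof (rule bounded_operatorsI[where B = "cmod c * B"])
    fix \<xi> assume "\<xi> \<in> ell2 X"
    then show "ell2_norm X (op_scale X c T \<xi>) \<le> cmod c * B * ell2_norm X \<xi>"
      using *(2) by (simp add: op_scale_def ell2_norm_scale mult.assoc mult_left_mono)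
  qed (use * in \<open>auto simp: op_scale_def bounded_operatorsD[OF T] ell2_add ell2_scale
      algebra_simps\<close>)
qed

lemma compose_bounded:
  assumes S: "S \<in> bounded_operators X" and T: "T \<in> bounded_operators X"
  shows "compose (ell2 X) S T \<in> bounded_operators X"
proof -
  obtain B C where *: "0 \<le> B" "\<And>\<xi>. \<xi> \<in> ell2 X \<Longrightarrow> ell2_norm X (S \<xi>) \<le> B * ell2_norm X \<xi>"
    "0 \<le> C" "\<And>\<xi>. \<xi> \<in> ell2 X \<Longrightarrow> ell2_norm X (T \<xi>) \<le> C * ell2_norm X \<xi>"
    using bounded_operators_bound S T by metis
  show ?thesis
  proof (rule bounded_operatorsI[where B = "B * C"])
    fix \<xi> assume \<xi>: "\<xi> \<in> ell2 X"
    have "ell2_norm X (S (T \<xi>)) \<le> B * ell2_norm X (T \<xi>)"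
      by (rule *(2)[OF bounded_operatorsD(1)[OF T \<xi>]])
    also have "\<dots> \<le> B * (C * ell2_norm X \<xi>)"
      using * \<xi> by (intro mult_left_mono) auto
    finally show "ell2_norm X (compose (ell2 X) S T \<xi>) \<le> B * C * ell2_norm X \<xi>"
      using \<xi> by (simp add: compose_def mult.assoc)
  qed (use * in \<open>auto simp: compose_def bounded_operatorsD[OF S] bounded_operatorsD[OF T]
      ell2_add ell2_scale\<close>)
qed

lemma op_zero_bounded: "(\<lambda>\<xi>\<in>ell2 X. \<lambda>x. 0) \<in> bounded_operators X"
  by (rule bounded_operatorsI[where B = 0])
    (auto simp: ell2_zero ell2_add ell2_scale ell2_norm_def)

section \<open>The reduced group C*-algebra\<close>

context group
begin

lemma left_regular_ell2:
  assumes g: "g \<in> carrier G" and \<xi>: "\<xi> \<in> ell2 (carrier G)"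
  shows "left_regular G g \<xi> \<in> ell2 (carrier G)"
    and "ell2_norm (carrier G) (left_regular G g \<xi>) = ell2_norm (carrier G) \<xi>"
proof -
  have bij: "bij_betw (\<lambda>h. inv g \<otimes> h) (carrier G) (carrier G)"
    using g by (intro bij_betw_byWitness[where f' = "\<lambda>h. g \<otimes> h"]) (auto simp flip: m_assoc)
  have eq: "(cmod (left_regular G g \<xi> h))\<^sup>2 = (cmod (\<xi> (inv g \<otimes> h)))\<^sup>2" if "h \<in> carrier G" for h
    using that \<xi> by (simp add: left_regular_def)
  have "(\<lambda>h. (cmod (left_regular G g \<xi> h))\<^sup>2) summable_on carrier G \<longleftrightarrow>
      (\<lambda>h. (cmod (\<xi> (inv g \<otimes> h)))\<^sup>2) summable_on carrier G"
    by (rule summable_on_cong) (rule eq)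
  also have "\<dots> \<longleftrightarrow> (\<lambda>h. (cmod (\<xi> h))\<^sup>2) summable_on carrier G"
    by (rule summable_on_reindex_bij_betw[OF bij])
  finally show "left_regular G g \<xi> \<in> ell2 (carrier G)"
    using \<xi> by (auto simp: ell2_def left_regular_def)
  have "(\<Sum>\<^sub>\<infinity>h\<in>carrier G. (cmod (left_regular G g \<xi> h))\<^sup>2) =
      (\<Sum>\<^sub>\<infinity>h\<in>carrier G. (cmod (\<xi> (inv g \<otimes> h)))\<^sup>2)"
    by (rule infsum_cong) (rule eq)
  also have "\<dots> = (\<Sum>\<^sub>\<infinity>h\<in>carrier G. (cmod (\<xi> h))\<^sup>2)"
    by (rule infsum_reindex_bij_betw[OF bij])
  finally show "ell2_norm (carrier G) (left_regular G g \<xi>) = ell2_norm (carrier G) \<xi>"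
    by (simp add: ell2_norm_def)
qed

lemma left_regular_bounded:
  assumes "g \<in> carrier G"
  shows "left_regular G g \<in> bounded_operators (carrier G)"
proof (rule bounded_operatorsI[where B = 1])
  show "left_regular G g \<in> extensional (ell2 (carrier G))"
    by (simp add: left_regular_def)
qed (auto simp: left_regular_ell2[OF assms], auto simp: left_regular_def ell2_add ell2_scale fun_eq_iff)

lemma left_regular_mult:
  assumes "g \<in> carrier G" "h \<in> carrier G" "\<xi> \<in> ell2 (carrier G)"
  shows "left_regular G g (left_regular G h \<xi>) = left_regular G (g \<otimes> h) \<xi>"
  using assms left_regular_ell2(1)[OF assms(2,3)]
  by (auto simp: left_regular_def fun_eq_iff inv_mult_group m_assoc)

lemma zero_in_group_algebra: "(\<lambda>\<xi>\<in>ell2 (carrier G). \<lambda>h. 0) \<in> group_algebra G"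
  unfolding group_algebra_def by (rule CollectI, rule exI[of _ "{}"]) simp

lemma group_algebra_scaled:
  assumes "g \<in> carrier G"
  shows "op_scale (carrier G) c (left_regular G g) \<in> group_algebra G"
  unfolding group_algebra_def using assms
  by (intro CollectI exI[of _ "{g}"] exI[of _ "\<lambda>_. c"]) (simp add: op_scale_def)

lemma group_algebra_add:
  assumes "S \<in> group_algebra G" "T \<in> group_algebra G"
  shows "op_add (carrier G) S T \<in> group_algebra G"
proof -
  obtain F c K d where S: "S = (\<lambda>\<xi>\<in>ell2 (carrier G). \<lambda>h. \<Sum>g\<in>F. c g * left_regular G g \<xi> h)"
    and F: "finite F" "F \<subseteq> carrier G"
    and T: "T = (\<lambda>\<xi>\<in>ell2 (carrier G). \<lambda>h. \<Sum>g\<in>K. d g * left_regular G g \<xi> h)"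
    and K: "finite K" "K \<subseteq> carrier G"
    using assms by (auto simp: group_algebra_def)
  define e where "e = (\<lambda>g. (if g \<in> F then c g else 0) + (if g \<in> K then d g else 0))"
  have "(\<Sum>g\<in>F \<union> K. e g * f g) = (\<Sum>g\<in>F. c g * f g) + (\<Sum>g\<in>K. d g * f g)" for f
  proof -
    have "(\<Sum>g\<in>F \<union> K. (if g \<in> F then c g else 0) * f g) = (\<Sum>g\<in>F. c g * f g)"
      using F K by (intro sum.mono_neutral_cong_right) auto
    moreover have "(\<Sum>g\<in>F \<union> K. (if g \<in> K then d g else 0) * f g) = (\<Sum>g\<in>K. d g * f g)"
      using F K by (intro sum.mono_neutral_cong_right) auto
    ultimately show ?thesis
      by (simp add: e_def distrib_right sum.distrib)
  qed
  then have "op_add (carrier G) S T =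
      (\<lambda>\<xi>\<in>ell2 (carrier G). \<lambda>h. \<Sum>g\<in>F \<union> K. e g * left_regular G g \<xi> h)"
    by (auto simp: op_add_def S T fun_eq_iff)
  then show ?thesis
    unfolding group_algebra_def using F K by blast
qed

text \<open>Induction on the support \<open>F\<close>, peeling off one translation at a time. It
  reduces closure properties of the group algebra to single translations.\<close>

lemma group_algebra_induct [consumes 1, case_names zero add]:
  assumes "S \<in> group_algebra G"
    and zero: "P (\<lambda>\<xi>\<in>ell2 (carrier G). \<lambda>h. 0)"
    and add: "\<And>c g T. g \<in> carrier G \<Longrightarrow> T \<in> group_algebra G \<Longrightarrow> P T \<Longrightarrow>
      P (op_add (carrier G) (op_scale (carrier G) c (left_regular G g)) T)"
  shows "P S"
proof -
  obtain F c where S: "S = (\<lambda>\<xi>\<in>ell2 (carrier G). \<lambda>h. \<Sum>g\<in>F. c g * left_regular G g \<xi> h)"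
    and F: "finite F" "F \<subseteq> carrier G"
    using assms(1) by (auto simp: group_algebra_def)
  from F show ?thesis
    unfolding S
  proof (induction F)
    case empty
    show ?case
      using zero by (simp only: sum.empty)
  next
    case (insert g F)
    let ?T = "\<lambda>\<xi>\<in>ell2 (carrier G). \<lambda>h. \<Sum>g\<in>F. c g * left_regular G g \<xi> h"
    have "?T \<in> group_algebra G"
      using insert unfolding group_algebra_def by blast
    moreover have "P ?T"
      using insert by blast
    ultimately have "P (op_add (carrier G) (op_scale (carrier G) (c g) (left_regular G g)) ?T)"
      using insert.prems by (intro add) blast+
    also have "op_add (carrier G) (op_scale (carrier G) (c g) (left_regular G g)) ?T =
        (\<lambda>\<xi>\<in>ell2 (carrier G). \<lambda>h. \<Sum>g\<in>insert g F. c g * left_regular G g \<xi> h)"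
      using insert by (auto simp: op_add_def op_scale_def fun_eq_iff)
    finally show ?case .
  qed
qed

lemma group_algebra_bounded: "S \<in> group_algebra G \<Longrightarrow> S \<in> bounded_operators (carrier G)"
proof (induction rule: group_algebra_induct)
  case zero
  show ?case
    by (rule op_zero_bounded)
qed (intro op_add_bounded op_scale_bounded left_regular_bounded)

lemma group_algebra_scale:
  assumes "S \<in> group_algebra G"
  shows "op_scale (carrier G) c S \<in> group_algebra G"
proof -
  obtain F d where S: "S = (\<lambda>\<xi>\<in>ell2 (carrier G). \<lambda>h. \<Sum>g\<in>F. d g * left_regular G g \<xi> h)"
    and F: "finite F" "F \<subseteq> carrier G"
    using assms by (auto simp: group_algebra_def)
  have "op_scale (carrier G) c S =
      (\<lambda>\<xi>\<in>ell2 (carrier G). \<lambda>h. \<Sum>g\<in>F. (c * d g) * left_regular G g \<xi> h)"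
    by (auto simp: op_scale_def S fun_eq_iff sum_distrib_left mult.assoc)
  then show ?thesis
    unfolding group_algebra_def using F by (intro CollectI exI[of _ F] exI[of _ "\<lambda>g. c * d g"]) auto
qed

text \<open>Bilinearity reduces the claim to \<open>left_regular_mult\<close>: the right factor is
  built up first, against a single translation on the left, and then the left factor is built
  up.\<close>

lemma group_algebra_compose:
  assumes "S \<in> group_algebra G" "T \<in> group_algebra G"
  shows "compose (ell2 (carrier G)) S T \<in> group_algebra G"
proof -
  let ?X = "carrier G"
  have left: "compose (ell2 ?X) (left_regular G g) T \<in> group_algebra G"
    if g: "g \<in> ?X" for g
    using assms(2)
  proof (induction rule: group_algebra_induct)
    case zero
    have "compose (ell2 ?X) (left_regular G g) (\<lambda>\<xi>\<in>ell2 ?X. \<lambda>h. 0) = (\<lambda>\<xi>\<in>ell2 ?X. \<lambda>h. 0)"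
      by (auto simp: compose_def left_regular_def fun_eq_iff ell2_zero)
    then show ?case
      using zero_in_group_algebra by (simp only:)
  next
    case (add c h T)
    note B = left_regular_bounded[OF g]
    have "compose (ell2 ?X) (left_regular G g) (op_add ?X (op_scale ?X c (left_regular G h)) T) =
       op_add ?X (op_scale ?X c (left_regular G (g \<otimes> h))) (compose (ell2 ?X) (left_regular G g) T)"
    proof
      fix \<xi>
      show "compose (ell2 ?X) (left_regular G g) (op_add ?X (op_scale ?X c (left_regular G h)) T) \<xi> =
       op_add ?X (op_scale ?X c (left_regular G (g \<otimes> h))) (compose (ell2 ?X) (left_regular G g) T) \<xi>"
      proof (cases "\<xi> \<in> ell2 ?X")
        case True
        note * = left_regular_ell2(1)[OF add(1) True]
        show ?thesis
          using True bounded_operatorsD(2)[OF B ell2_scale[OF *]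
              bounded_operatorsD(1)[OF group_algebra_bounded[OF add(2)] True], of c]
            bounded_operatorsD(3)[OF B *, of c] left_regular_mult[OF g add(1) True]
          by (simp add: compose_def op_add_def op_scale_def)
      qed (simp add: compose_def op_add_def)
    qed
    then show ?case
      using add g by (simp add: group_algebra_add group_algebra_scaled)
  qed
  show ?thesis
    using assms(1)
  proof (induction rule: group_algebra_induct)
    case zero
    have "compose (ell2 ?X) (\<lambda>\<xi>\<in>ell2 ?X. \<lambda>h. 0) T = ((\<lambda>\<xi>\<in>ell2 ?X. \<lambda>h. 0) :: 'a operator)"
      using bounded_operatorsD(1)[OF group_algebra_bounded[OF assms(2)]]
      by (auto simp: compose_def fun_eq_iff)
    then show ?case
      using zero_in_group_algebra by (simp only:)
  next
    case (add c g S)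
    have "compose (ell2 ?X) (op_add ?X (op_scale ?X c (left_regular G g)) S) T =
       op_add ?X (op_scale ?X c (compose (ell2 ?X) (left_regular G g) T)) (compose (ell2 ?X) S T)"
      using bounded_operatorsD(1)[OF group_algebra_bounded[OF assms(2)]]
      by (auto simp: compose_def op_add_def op_scale_def fun_eq_iff)
    then show ?case
      using add by (simp add: group_algebra_add group_algebra_scale left)
  qed
qed

section \<open>Norm approximation and closure properties of the reduced C*-algebra\<close>

abbreviation "approximates S T e \<equiv> \<forall>\<xi>\<in>ell2 (carrier G).
  ell2_norm (carrier G) (\<lambda>x. T \<xi> x - S \<xi> x) \<le> e * ell2_norm (carrier G) \<xi>"

text \<open>Turns the \<open>ennreal\<close> distance into a real inequality for each vector, the
  form in which approximations can be added and composed.\<close>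

lemma reduced_cstar_iff:
  "T \<in> reduced_group_cstar_algebra G \<longleftrightarrow> T \<in> bounded_operators (carrier G) \<and>
    (\<forall>e>0. \<exists>S\<in>group_algebra G. approximates S T e)" (is "_ \<longleftrightarrow> ?rhs")
proof
  assume T: "T \<in> reduced_group_cstar_algebra G"
  show ?rhs
  proof (intro conjI allI impI)
    show B: "T \<in> bounded_operators (carrier G)"
      using T by (simp add: reduced_group_cstar_algebra_def)
    fix e :: real assume e: "e > 0"
    then have "ennreal e > 0"
      by simp
    then obtain S where S: "S \<in> group_algebra G"
      "operator_norm (carrier G) (ell2 (carrier G)) (\<lambda>\<xi> x. T \<xi> x - S \<xi> x) < ennreal e"
      using T unfolding reduced_group_cstar_algebra_def by blast
    have "ell2_norm (carrier G) (\<lambda>x. T \<xi> x - S \<xi> x) \<le> e * ell2_norm (carrier G) \<xi>"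
      if "\<xi> \<in> ell2 (carrier G)" for \<xi>
      using that S e bounded_operatorsD(3)[OF B]
        bounded_operatorsD(3)[OF group_algebra_bounded[OF S(1)]]
      by (intro operator_norm_bound[where T = "\<lambda>\<xi> x. T \<xi> x - S \<xi> x"])
        (auto simp: right_diff_distrib)
    with S(1) show "\<exists>S\<in>group_algebra G. approximates S T e"
      by blast
  qed
next
  assume R: ?rhs
  have "\<exists>S\<in>group_algebra G.
      operator_norm (carrier G) (ell2 (carrier G)) (\<lambda>\<xi> x. T \<xi> x - S \<xi> x) < e"
    if "e > 0" for e
  proof -
    \<comment> \<open>A positive real below \<open>e\<close>, which may itself be infinite.\<close>
    obtain e' where e': "e' > 0" "ennreal e' < e"
    proof (cases e)
      case (real r)
      then show ?thesis
        using \<open>e > 0\<close> by (intro that[of "r / 2"]) (auto intro: ennreal_lessI)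
    next
      case top
      then show ?thesis
        by (intro that[of 1]) auto
    qed
    obtain S where S: "S \<in> group_algebra G" "approximates S T e'"
      using R e'(1) by blast
    have "operator_norm (carrier G) (ell2 (carrier G)) (\<lambda>\<xi> x. T \<xi> x - S \<xi> x) \<le> ennreal e'"
      using S(2) e'(1) by (intro operator_norm_le) auto
    with S(1) e'(2) show ?thesis
      by (auto intro: le_less_trans)
  qed
  with R show "T \<in> reduced_group_cstar_algebra G"
    by (simp add: reduced_group_cstar_algebra_def)
qed

lemma group_algebra_subset: "group_algebra G \<subseteq> reduced_group_cstar_algebra G"
proof
  fix S assume S: "S \<in> group_algebra G"
  have "ell2_norm (carrier G) (\<lambda>x. 0) = 0"
    by (simp add: ell2_norm_def)
  then have "approximates S S e" if "e > 0" for e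
    using that by simp
  with S group_algebra_bounded[OF S] show "S \<in> reduced_group_cstar_algebra G"
    unfolding reduced_cstar_iff by blast
qed

lemma op_id_in_reduced_cstar: "op_id (carrier G) \<in> reduced_group_cstar_algebra G"
proof -
  have "op_id (carrier G) = op_scale (carrier G) 1 (left_regular G \<one>)"
    by (auto simp: op_id_def op_scale_def left_regular_def fun_eq_iff ell2_zero_outside)
  then show ?thesis
    using group_algebra_scaled[of \<one> 1] group_algebra_subset by auto
qed

text \<open>This and the next two lemmas serve to verify the axioms of a state:
  \<open>uniform_state\<close> is \<open>undefined\<close> outside the algebra, so it can be
  evaluated on sums, multiples and products only once these are known to belong to it.\<close>

lemma op_add_in_reduced_cstar:
  assumes S: "S \<in> reduced_group_cstar_algebra G" and T: "T \<in> reduced_group_cstar_algebra G"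
  shows "op_add (carrier G) S T \<in> reduced_group_cstar_algebra G"
  unfolding reduced_cstar_iff
proof (intro conjI allI impI)
  let ?X = "carrier G"
  have B: "S \<in> bounded_operators ?X" "T \<in> bounded_operators ?X"
    using S T by (simp_all add: reduced_cstar_iff)
  then show "op_add ?X S T \<in> bounded_operators ?X"
    by (rule op_add_bounded)
  fix e :: real assume "e > 0"
  then have "e / 2 > 0"
    by simp
  then have "\<exists>S'\<in>group_algebra G. approximates S' S (e / 2)" "\<exists>T'\<in>group_algebra G. approximates T' T (e / 2)"
    using S T unfolding reduced_cstar_iff by blast+
  then obtain S' T' where *: "S' \<in> group_algebra G" "approximates S' S (e / 2)"
    "T' \<in> group_algebra G" "approximates T' T (e / 2)"
    by blast
  note B' = group_algebra_bounded[OF *(1)] group_algebra_bounded[OF *(3)]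
  have "ell2_norm ?X (\<lambda>x. op_add ?X S T \<xi> x - op_add ?X S' T' \<xi> x) \<le> e * ell2_norm ?X \<xi>"
    if \<xi>: "\<xi> \<in> ell2 ?X" for \<xi>
  proof -
    have "(\<lambda>x. op_add ?X S T \<xi> x - op_add ?X S' T' \<xi> x) = (\<lambda>x. (S \<xi> x - S' \<xi> x) + (T \<xi> x - T' \<xi> x))"
      using \<xi> by (auto simp: op_add_def)
    moreover have "ell2_norm ?X (\<lambda>x. (S \<xi> x - S' \<xi> x) + (T \<xi> x - T' \<xi> x))
        \<le> ell2_norm ?X (\<lambda>x. S \<xi> x - S' \<xi> x) + ell2_norm ?X (\<lambda>x. T \<xi> x - T' \<xi> x)"
      by (intro ell2_add(2) ell2_diff bounded_operatorsD(1)[OF B(1) \<xi>] bounded_operatorsD(1)[OF B(2) \<xi>]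
          bounded_operatorsD(1)[OF B'(1) \<xi>] bounded_operatorsD(1)[OF B'(2) \<xi>])
    moreover have "\<dots> \<le> e / 2 * ell2_norm ?X \<xi> + e / 2 * ell2_norm ?X \<xi>"
      using * \<xi> by (intro add_mono) auto
    ultimately show ?thesis
      by simp
  qed
  then show "\<exists>R\<in>group_algebra G. approximates R (op_add ?X S T) e"
    using group_algebra_add[OF *(1,3)] by blast
qed

lemma op_scale_in_reduced_cstar:
  assumes T: "T \<in> reduced_group_cstar_algebra G"
  shows "op_scale (carrier G) c T \<in> reduced_group_cstar_algebra G"
  unfolding reduced_cstar_iff
proof (intro conjI allI impI)
  let ?X = "carrier G"
  have B: "T \<in> bounded_operators ?X"
    using T by (simp add: reduced_cstar_iff)
  then show "op_scale ?X c T \<in> bounded_operators ?X"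
    by (rule op_scale_bounded)
  fix e :: real assume e: "e > 0"
  \<comment> \<open>The summand \<open>1\<close> keeps the denominator positive when
    \<open>c = 0\<close>.\<close>
  then have "e / (cmod c + 1) > 0"
    by (simp add: add_nonneg_pos)
  then obtain T' where *: "T' \<in> group_algebra G" "approximates T' T (e / (cmod c + 1))"
    using T unfolding reduced_cstar_iff by blast
  have "ell2_norm ?X (\<lambda>x. op_scale ?X c T \<xi> x - op_scale ?X c T' \<xi> x) \<le> e * ell2_norm ?X \<xi>"
    if \<xi>: "\<xi> \<in> ell2 ?X" for \<xi>
  proof -
    have "(\<lambda>x. op_scale ?X c T \<xi> x - op_scale ?X c T' \<xi> x) = (\<lambda>x. c * (T \<xi> x - T' \<xi> x))"
      using \<xi> by (auto simp: op_scale_def right_diff_distrib)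
    then have "ell2_norm ?X (\<lambda>x. op_scale ?X c T \<xi> x - op_scale ?X c T' \<xi> x) =
        cmod c * ell2_norm ?X (\<lambda>x. T \<xi> x - T' \<xi> x)"
      by (simp add: ell2_norm_scale)
    also have "\<dots> \<le> (cmod c + 1) * (e / (cmod c + 1) * ell2_norm ?X \<xi>)"
      using * \<xi> by (intro mult_mono) auto
    also have "\<dots> = e * ell2_norm ?X \<xi>"
      using norm_ge_zero[of c] by (simp add: add_nonneg_eq_0_iff)
    finally show ?thesis .
  qed
  then show "\<exists>R\<in>group_algebra G. approximates R (op_scale ?X c T) e"
    using group_algebra_scale[OF *(1)] by blast
qed

lemma compose_in_reduced_cstar:
  assumes S: "S \<in> reduced_group_cstar_algebra G" and T: "T \<in> reduced_group_cstar_algebra G"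
  shows "compose (ell2 (carrier G)) S T \<in> reduced_group_cstar_algebra G"
  unfolding reduced_cstar_iff
proof (intro conjI allI impI)
  let ?X = "carrier G"
  have B: "S \<in> bounded_operators ?X" "T \<in> bounded_operators ?X"
    using S T by (simp_all add: reduced_cstar_iff)
  then show "compose (ell2 ?X) S T \<in> bounded_operators ?X"
    by (rule compose_bounded)
  obtain C where C: "0 \<le> C" "\<And>\<xi>. \<xi> \<in> ell2 ?X \<Longrightarrow> ell2_norm ?X (S \<xi>) \<le> C * ell2_norm ?X \<xi>"
    using bounded_operators_bound[OF B(1)] by blast
  fix e :: real assume e: "e > 0"
  \<comment> \<open>The estimate rests on S T - S' T' = S (T - T') + (S - S') T'. The tolerance
    \<open>r\<close> for \<open>T'\<close> depends on the bound \<open>C\<close> of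
    \<open>S\<close>; the tolerance \<open>s\<close> for \<open>S'\<close> has to wait until
    \<open>T'\<close> and its bound \<open>C'\<close> are fixed.\<close>
  define r where "r = e / 2 / (C + 1)"
  have r: "r > 0"
    using e C by (simp add: r_def add_nonneg_pos)
  obtain T' where T': "T' \<in> group_algebra G" "approximates T' T r"
    using T r unfolding reduced_cstar_iff by blast
  note BT' = group_algebra_bounded[OF T'(1)]
  obtain C' where C': "0 \<le> C'" "\<And>\<xi>. \<xi> \<in> ell2 ?X \<Longrightarrow> ell2_norm ?X (T' \<xi>) \<le> C' * ell2_norm ?X \<xi>"
    using bounded_operators_bound[OF BT'] by blast
  define s where "s = e / 2 / (C' + 1)"
  have s: "s > 0"
    using e C' by (simp add: s_def add_nonneg_pos)
  obtain S' where S': "S' \<in> group_algebra G" "approximates S' S s"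
    using S s unfolding reduced_cstar_iff by blast
  note BS' = group_algebra_bounded[OF S'(1)]
  have rs: "C * r + s * C' \<le> e"
  proof -
    have "C * r \<le> e / 2" "s * C' \<le> e / 2"
      using C C' e by (simp_all add: r_def s_def field_simps)
    then show ?thesis by simp
  qed
  have "ell2_norm ?X (\<lambda>x. compose (ell2 ?X) S T \<xi> x - compose (ell2 ?X) S' T' \<xi> x) \<le> e * ell2_norm ?X \<xi>"
    if \<xi>: "\<xi> \<in> ell2 ?X" for \<xi>
  proof -
    let ?\<eta> = "\<lambda>x. T \<xi> x - T' \<xi> x"
    have T\<xi>: "T \<xi> \<in> ell2 ?X" "T' \<xi> \<in> ell2 ?X"
      using \<xi> B BT' by (auto intro: bounded_operatorsD)
    have \<eta>: "?\<eta> \<in> ell2 ?X"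
      by (rule ell2_diff[OF T\<xi>])
    have "(\<lambda>x. compose (ell2 ?X) S T \<xi> x - compose (ell2 ?X) S' T' \<xi> x) =
        (\<lambda>x. S ?\<eta> x + (S (T' \<xi>) x - S' (T' \<xi>) x))"
      using \<xi> by (simp add: compose_def bounded_operators_diff[OF B(1) T\<xi>])
    then have "ell2_norm ?X (\<lambda>x. compose (ell2 ?X) S T \<xi> x - compose (ell2 ?X) S' T' \<xi> x)
        \<le> ell2_norm ?X (S ?\<eta>) + ell2_norm ?X (\<lambda>x. S (T' \<xi>) x - S' (T' \<xi>) x)"
      using B BS' T\<xi> \<eta> by (simp add: ell2_add ell2_diff bounded_operatorsD(1))
    also have "\<dots> \<le> C * (r * ell2_norm ?X \<xi>) + s * (C' * ell2_norm ?X \<xi>)"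
    proof (rule add_mono)
      show "ell2_norm ?X (S ?\<eta>) \<le> C * (r * ell2_norm ?X \<xi>)"
        using C(2)[OF \<eta>] T' \<xi> C(1) by (meson mult_left_mono order_trans)
      show "ell2_norm ?X (\<lambda>x. S (T' \<xi>) x - S' (T' \<xi>) x) \<le> s * (C' * ell2_norm ?X \<xi>)"
        using S'(2) T\<xi>(2) C'(2)[OF \<xi>] s by (meson mult_left_mono order_trans less_imp_le)
    qed
    also have "\<dots> = (C * r + s * C') * ell2_norm ?X \<xi>"
      by (simp add: algebra_simps)
    also have "\<dots> \<le> e * ell2_norm ?X \<xi>"
      using rs by (intro mult_right_mono) auto
    finally show ?thesis .
  qed
  then show "\<exists>R\<in>group_algebra G. approximates R (compose (ell2 ?X) S T) e"
    using group_algebra_compose[OF S'(1) T'(1)] by blast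
qed

section \<open>Vector states of finite subgroups\<close>

definition uniform_vector :: "'a set \<Rightarrow> 'a \<Rightarrow> complex"
  where "uniform_vector H x = (if x \<in> H then 1 / sqrt (card H) else 0)"

definition uniform_state :: "'a set \<Rightarrow> 'a operator \<Rightarrow> complex"
  where "uniform_state H = (\<lambda>T\<in>reduced_group_cstar_algebra G.
    ell2_inner (carrier G) (T (uniform_vector H)) (uniform_vector H))"

lemma uniform_vector:
  assumes "finite H" "H \<subseteq> carrier G" "H \<noteq> {}"
  shows "uniform_vector H \<in> ell2 (carrier G)" "ell2_norm (carrier G) (uniform_vector H) = 1"
proof -
  have *: "uniform_vector H x = 0" if "x \<notin> H" for x
    using that by (simp add: uniform_vector_def)
  show "uniform_vector H \<in> ell2 (carrier G)"
    by (rule ell2_finite_support(1)[OF assms(1,2) *])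
  have "ell2_norm (carrier G) (uniform_vector H) = L2_set (\<lambda>x. cmod (uniform_vector H x)) H"
    by (rule ell2_finite_support(2)[OF assms(1,2) *])
  also have "\<dots> = L2_set (\<lambda>x. 1 / sqrt (card H)) H"
    by (rule L2_set_cong) (simp_all add: uniform_vector_def norm_divide)
  also have "\<dots> = 1"
    using assms(1,3) by (simp add: L2_set_def power_divide)
  finally show "ell2_norm (carrier G) (uniform_vector H) = 1" .
qed

lemma ell2_inner_uniform_vector:
  assumes "finite H" "H \<subseteq> carrier G"
  shows "ell2_inner (carrier G) \<xi> (uniform_vector H) = (\<Sum>x\<in>H. \<xi> x) / sqrt (card H)"
proof -
  have "ell2_inner (carrier G) \<xi> (uniform_vector H) = (\<Sum>x\<in>H. \<xi> x * cnj (uniform_vector H x))"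
    by (rule ell2_inner_finite_support[OF assms]) (simp add: uniform_vector_def)
  also have "\<dots> = (\<Sum>x\<in>H. \<xi> x / sqrt (card H))"
    by (rule sum.cong) (simp_all add: uniform_vector_def)
  finally show ?thesis
    by (simp add: sum_divide_distrib)
qed

text \<open>It is the vector state of a unit vector \<xi>. Positivity holds because the inner
  product of T' T \<xi> with \<xi> is the squared norm of T \<xi> when T' is the adjoint of
  T.\<close>

lemma uniform_state_in_states:
  assumes H: "finite H" "H \<subseteq> carrier G" "H \<noteq> {}"
  shows "uniform_state H \<in> states (carrier G) (reduced_group_cstar_algebra G)"
proof -
  let ?X = "carrier G" and ?\<xi> = "uniform_vector H" and ?A = "reduced_group_cstar_algebra G"
  note \<xi> = uniform_vector[OF H] and inner = ell2_inner_uniform_vector[OF H(1,2)]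
  have "uniform_state H (op_add ?X S T) = uniform_state H S + uniform_state H T"
    if "S \<in> ?A" "T \<in> ?A" for S T
    using that op_add_in_reduced_cstar[OF that] \<xi>(1)
    by (simp add: uniform_state_def inner op_add_def sum.distrib add_divide_distrib)
  moreover have "uniform_state H (op_scale ?X c T) = c * uniform_state H T" if "T \<in> ?A" for c T
    using that op_scale_in_reduced_cstar[OF that] \<xi>(1)
    by (simp add: uniform_state_def inner op_scale_def flip: sum_distrib_left)
  moreover have "uniform_state H (compose (ell2 ?X) T' T) \<in> \<real> \<and>
      0 \<le> Re (uniform_state H (compose (ell2 ?X) T' T))"
    if T: "T \<in> ?A" and T': "T' \<in> ?A" and adj: "is_adjoint ?X T T'" for T T'
  proof -
    have T\<xi>: "T ?\<xi> \<in> ell2 ?X"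
      using T \<xi>(1) by (auto simp: reduced_cstar_iff intro: bounded_operatorsD)
    have "uniform_state H (compose (ell2 ?X) T' T) = ell2_inner ?X (T' (T ?\<xi>)) ?\<xi>"
      using compose_in_reduced_cstar[OF T' T] \<xi>(1) by (simp add: uniform_state_def compose_def)
    also have "\<dots> = cnj (ell2_inner ?X ?\<xi> (T' (T ?\<xi>)))"
      by (rule ell2_inner_cnj)
    also have "ell2_inner ?X ?\<xi> (T' (T ?\<xi>)) = ell2_inner ?X (T ?\<xi>) (T ?\<xi>)"
      using adj T\<xi> \<xi>(1) by (simp add: is_adjoint_def)
    also have "\<dots> = of_real ((ell2_norm ?X (T ?\<xi>))\<^sup>2)"
      by (rule ell2_inner_self[OF T\<xi>])
    finally show ?thesis
      by simp
  qed
  moreover have "uniform_state H (op_id ?X) = 1"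
    using op_id_in_reduced_cstar \<xi> ell2_inner_self[OF \<xi>(1)]
    by (simp add: uniform_state_def op_id_def)
  ultimately show ?thesis
    by (simp add: states_def uniform_state_def[abs_def])
qed

text \<open>Translation by g carries the indicator function of H to that of the coset gH, which
  equals H or is disjoint from it. So each translation contributes its full coefficient or nothing.
  For the trivial subgroup this is the canonical trace.\<close>

lemma uniform_state_group_algebra:
  assumes H: "finite H" "subgroup H G" and F: "finite F" "F \<subseteq> carrier G"
  shows "uniform_state H (\<lambda>\<xi>\<in>ell2 (carrier G). \<lambda>h. \<Sum>g\<in>F. c g * left_regular G g \<xi> h) =
    (\<Sum>g\<in>F. c g * of_bool (g \<in> H))"
proof -
  let ?S = "\<lambda>\<xi>\<in>ell2 (carrier G). \<lambda>h. \<Sum>g\<in>F. c g * left_regular G g \<xi> h"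
  interpret H: subgroup H G by fact
  have H': "H \<subseteq> carrier G" "H \<noteq> {}"
    using H.subset H.one_closed by blast+
  note \<xi> = uniform_vector[OF H(1) H']
  have card: "card H > 0"
    using H(1) H' by (simp add: card_gt_0_iff)
  have mem: "inv g \<otimes> x \<in> H \<longleftrightarrow> g \<in> H" if "g \<in> carrier G" "x \<in> H" for g x
  proof
    assume "inv g \<otimes> x \<in> H"
    then have "x \<otimes> inv (inv g \<otimes> x) \<in> H"
      by (intro H.m_closed[OF that(2)] H.m_inv_closed)
    also have "x \<otimes> inv (inv g \<otimes> x) = g"
      using that(1) H.mem_carrier[OF that(2)] by (simp add: inv_mult_group flip: m_assoc)
    finally show "g \<in> H" .
  next
    assume "g \<in> H"
    then show "inv g \<otimes> x \<in> H"
      using that by (intro H.m_closed H.m_inv_closed)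
  qed
  have L: "(\<Sum>x\<in>H. left_regular G g (uniform_vector H) x) = of_bool (g \<in> H) * complex_of_real (sqrt (card H))"
    if g: "g \<in> carrier G" for g
  proof -
    have "(\<Sum>x\<in>H. left_regular G g (uniform_vector H) x) =
        (\<Sum>x\<in>H. of_bool (g \<in> H) / complex_of_real (sqrt (card H)))"
      using H' \<xi>(1) g by (intro sum.cong) (auto simp: left_regular_def uniform_vector_def mem)
    also have "\<dots> = of_bool (g \<in> H) * of_real (card H / sqrt (card H))"
      by simp
    also have "card H / sqrt (card H) = sqrt (card H)"
      by (simp add: real_div_sqrt)
    finally show ?thesis by simp
  qed
  have "?S \<in> group_algebra G"
    unfolding group_algebra_def using F by blast
  then have "?S \<in> reduced_group_cstar_algebra G"
    using group_algebra_subset by auto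
  then have "uniform_state H ?S =
      (\<Sum>x\<in>H. \<Sum>g\<in>F. c g * left_regular G g (uniform_vector H) x) / sqrt (card H)"
    using \<xi>(1) by (simp add: uniform_state_def ell2_inner_uniform_vector[OF H(1) H'(1)])
  also have "(\<Sum>x\<in>H. \<Sum>g\<in>F. c g * left_regular G g (uniform_vector H) x) =
      (\<Sum>g\<in>F. c g * (\<Sum>x\<in>H. left_regular G g (uniform_vector H) x))"
    by (subst sum.swap) (simp add: sum_distrib_left)
  also have "\<dots> = (\<Sum>g\<in>F. c g * of_bool (g \<in> H)) * sqrt (card H)"
    using F(2) by (simp add: sum_distrib_right L subset_iff mult.assoc)
  also have "(\<Sum>g\<in>F. c g * of_bool (g \<in> H)) * sqrt (card H) / sqrt (card H) =
      (\<Sum>g\<in>F. c g * of_bool (g \<in> H))"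
    using card by simp
  finally show ?thesis .
qed

text \<open>A vector state of a unit vector changes by at most the operator distance. The bound is
  the same for all \<open>H\<close>, which allows passing to the norm closure in the limit
  below.\<close>

lemma uniform_state_approx:
  assumes H: "finite H" "H \<subseteq> carrier G" "H \<noteq> {}" and S: "S \<in> group_algebra G"
    and T: "T \<in> reduced_group_cstar_algebra G" and approx: "approximates S T e"
  shows "cmod (uniform_state H T - uniform_state H S) \<le> e"
proof -
  let ?X = "carrier G" and ?\<xi> = "uniform_vector H"
  note \<xi> = uniform_vector[OF H]
  have TS: "T ?\<xi> \<in> ell2 ?X" "S ?\<xi> \<in> ell2 ?X"
    using T \<xi>(1) group_algebra_bounded[OF S] by (auto simp: reduced_cstar_iff intro: bounded_operatorsD)
  have "uniform_state H T - uniform_state H S = ell2_inner ?X (\<lambda>x. T ?\<xi> x - S ?\<xi> x) ?\<xi>"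
    using T S group_algebra_subset
    by (auto simp: uniform_state_def ell2_inner_uniform_vector[OF H(1,2)] sum_subtractf diff_divide_distrib)
  also have "cmod \<dots> \<le> ell2_norm ?X (\<lambda>x. T ?\<xi> x - S ?\<xi> x) * ell2_norm ?X ?\<xi>"
    using H TS by (intro cmod_ell2_inner_finite_support[of H] ell2_diff) (auto simp: uniform_vector_def)
  also have "\<dots> \<le> e"
    using bspec[OF approx \<xi>(1)] \<xi>(2) by simp
  finally show ?thesis .
qed

text \<open>On a fixed element of the group algebra the values are eventually constant, since every
  nontrivial element of its finite support leaves \<open>H n\<close>. The uniform estimate
  \<open>uniform_state_approx\<close> extends the convergence to the norm closure.\<close>

lemma uniform_states_tendsto:
  assumes H: "\<And>n. finite (H n)" "\<And>n. subgroup (H n) G"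
    and escape: "\<And>g. g \<in> carrier G \<Longrightarrow> g \<noteq> \<one> \<Longrightarrow> \<forall>\<^sub>F n in sequentially. g \<notin> H n"
    and T: "T \<in> reduced_group_cstar_algebra G"
  shows "(\<lambda>n. uniform_state (H n) T) \<longlonglongrightarrow> uniform_state {\<one>} T"
proof (rule tendstoI)
  fix e :: real assume "e > 0"
  then have "e / 3 > 0" by simp
  then obtain S where S: "S \<in> group_algebra G" "approximates S T (e / 3)"
    using T unfolding reduced_cstar_iff by blast
  obtain F c where S_eq: "S = (\<lambda>\<xi>\<in>ell2 (carrier G). \<lambda>h. \<Sum>g\<in>F. c g * left_regular G g \<xi> h)"
    and F: "finite F" "F \<subseteq> carrier G"
    using S(1) by (auto simp: group_algebra_def)
  have "\<forall>\<^sub>F n in sequentially. \<forall>g\<in>F - {\<one>}. g \<notin> H n"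
    using F escape by (intro eventually_ball_finite) auto
  then show "\<forall>\<^sub>F n in sequentially. dist (uniform_state (H n) T) (uniform_state {\<one>} T) < e"
  proof eventually_elim
    case (elim n)
    have one: "\<one> \<in> H n"
      using subgroup.one_closed[OF H(2)] .
    have "uniform_state (H n) S = uniform_state {\<one>} S"
      unfolding S_eq uniform_state_group_algebra[OF H F]
        uniform_state_group_algebra[OF finite.insertI[OF finite.emptyI] triv_subgroup F]
      using elim one by (intro sum.cong) auto
    moreover have "cmod (uniform_state (H n) T - uniform_state (H n) S) \<le> e / 3"
      using H(1) subgroup.subset[OF H(2)] one S T by (intro uniform_state_approx) auto
    moreover have "cmod (uniform_state {\<one>} T - uniform_state {\<one>} S) \<le> e / 3"
      using S T by (intro uniform_state_approx) auto
    \<comment> \<open>The values at \<open>S\<close> agree exactly, so only two errors of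
      \<open>e / 3\<close> occur and the total is strictly below \<open>e\<close>.\<close>
    ultimately have "dist (uniform_state (H n) T) (uniform_state {\<one>} T) \<le> e / 3 + e / 3"
      unfolding dist_norm by (metis (no_types) norm_diff_triangle_le norm_minus_commute)
    then show ?case
      using \<open>e > 0\<close> by simp
  qed
qed

end

section \<open>Balls of the spectral distance and a criterion for the topologies to differ\<close>

lemma spectral_dist_triangle:
  "spectral_dist X \<A> D \<phi> \<omega> \<le> spectral_dist X \<A> D \<phi> \<psi> + spectral_dist X \<A> D \<psi> \<omega>"
  unfolding spectral_dist_def
proof (rule SUP_least)
  let ?B = "{T \<in> \<A>. commutator_norm X D T \<le> 1}"
  fix T assume T: "T \<in> ?B"
  have "ennreal (cmod (\<phi> T - \<omega> T)) \<le> ennreal (cmod (\<phi> T - \<psi> T) + cmod (\<psi> T - \<omega> T))"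
    by (intro ennreal_leI) (metis diff_add_cancel add_diff_eq norm_triangle_ineq)
  also have "\<dots> = ennreal (cmod (\<phi> T - \<psi> T)) + ennreal (cmod (\<psi> T - \<omega> T))"
    by simp
  also have "\<dots> \<le> (SUP T\<in>?B. ennreal (cmod (\<phi> T - \<psi> T))) + (SUP T\<in>?B. ennreal (cmod (\<psi> T - \<omega> T)))"
    using T by (intro add_mono SUP_upper)
  finally show "ennreal (cmod (\<phi> T - \<omega> T)) \<le> \<dots>" .
qed

lemma openin_spectral_ball:
  "openin (ennreal_metric_topology M (spectral_dist X \<A> D)) {\<psi>\<in>M. spectral_dist X \<A> D \<phi> \<psi> < r}"
  unfolding openin_ennreal_metric_topology
proof (intro conjI ballI)
  let ?d = "spectral_dist X \<A> D"
  fix \<psi> assume "\<psi> \<in> {\<psi> \<in> M. ?d \<phi> \<psi> < r}"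
  then have \<psi>: "?d \<phi> \<psi> < r" by simp
  \<comment> \<open>Being below \<open>r\<close>, the distance from \<open>\<phi>\<close> to
    \<open>\<psi>\<close> is finite and can be cancelled in \<open>ennreal\<close>, even if
    \<open>r\<close> is infinite.\<close>
  have "?d \<phi> \<omega> < r" if "?d \<psi> \<omega> < r - ?d \<phi> \<psi>" for \<omega>
  proof -
    have "?d \<phi> \<omega> \<le> ?d \<phi> \<psi> + ?d \<psi> \<omega>"
      by (rule spectral_dist_triangle)
    also have "\<dots> < ?d \<phi> \<psi> + (r - ?d \<phi> \<psi>)"
      using that \<psi> by (intro ennreal_add_left_cancel_less[THEN iffD2]) auto
    also have "\<dots> = r"
      using \<psi> by (intro add_diff_inverse_ennreal) auto
    finally show ?thesis .
  qed
  moreover have "r - ?d \<phi> \<psi> > 0"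
    using \<psi> by (simp add: diff_gt_0_iff_gt_ennreal)
  ultimately show "\<exists>e>0. \<forall>\<omega>\<in>M. ?d \<psi> \<omega> < e \<longrightarrow> \<omega> \<in> {\<omega> \<in> M. ?d \<phi> \<omega> < r}"
    by blast
qed auto

text \<open>The rescaled averages over \<open>F n\<close> have commutator norm at most 1, vanish
  under the trace and take the value 1/M under the state of \<open>H n\<close>. So these states keep
  distance at least 1/M from the trace, although \<open>escape\<close> makes them converge to it in
  the weak-* topology. The metric ball of radius 1/M around the trace is therefore not weak-*
  open.\<close>

lemma (in group) not_spectral_metric_space:
  fixes M :: real
  assumes H: "\<And>n. finite (H n)" "\<And>n. subgroup (H n) G"
    and escape: "\<And>g. g \<in> carrier G \<Longrightarrow> g \<noteq> \<one> \<Longrightarrow> \<forall>\<^sub>F n in sequentially. g \<notin> H n"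
    and F: "\<And>n. F n \<subseteq> H n" "\<And>n. \<one> \<notin> F n" "\<And>n. F n \<noteq> {}"
    and M: "M > 0"
    and comm: "\<And>n. commutator_norm (carrier G) D (\<lambda>\<xi>\<in>ell2 (carrier G). \<lambda>h.
      \<Sum>g\<in>F n. of_real (1 / (M * card (F n))) * left_regular G g \<xi> h) \<le> 1"
  shows "\<not> spectral_metric_space (carrier G) (reduced_group_cstar_algebra G) (group_algebra G) D"
proof
  let ?X = "carrier G" and ?A = "reduced_group_cstar_algebra G"
  let ?d = "spectral_dist ?X (group_algebra G) D"
  assume "spectral_metric_space ?X ?A (group_algebra G) D"
  then have eq: "ennreal_metric_topology (states ?X ?A) ?d = weak_star_topology ?X ?A"
    by (simp add: spectral_metric_space_def)
  define \<tau> where "\<tau> = uniform_state {\<one>}"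
  define \<phi> where "\<phi> = (\<lambda>n. uniform_state (H n))"
  have \<tau>: "\<tau> \<in> states ?X ?A"
    unfolding \<tau>_def by (rule uniform_state_in_states) auto
  have H': "H n \<subseteq> ?X" "H n \<noteq> {}" for n
    using subgroup.subset[OF H(2)] subgroup.one_closed[OF H(2)] by auto
  have \<phi>: "\<phi> n \<in> states ?X ?A" for n
    unfolding \<phi>_def using H H' by (intro uniform_state_in_states)
  define U where "U = {\<psi> \<in> states ?X ?A. ?d \<tau> \<psi> < ennreal (1 / M)}"
  have "openin (weak_star_topology ?X ?A) U"
    unfolding U_def eq[symmetric] by (rule openin_spectral_ball)
  moreover have "?d \<tau> \<tau> \<le> 0"
    unfolding spectral_dist_def by (rule SUP_least) simp
  then have "\<tau> \<in> U"
    using \<tau> M by (simp add: U_def)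
  moreover have "limitin (weak_star_topology ?X ?A) \<phi> \<tau> sequentially"
    unfolding weak_star_topology_def limitin_subtopology limitin_componentwise
  proof (intro conjI ballI)
    show "\<tau> \<in> extensional ?A"
      using \<tau> by (simp add: states_def)
    show "\<forall>\<^sub>F n in sequentially. \<phi> n \<in> topspace (product_topology (\<lambda>_. euclidean) ?A)"
      using \<phi> by (auto simp: states_def PiE_def)
    show "\<forall>\<^sub>F n in sequentially. \<phi> n \<in> states ?X ?A"
      using \<phi> by simp
    fix T assume "T \<in> ?A"
    then have "(\<lambda>n. \<phi> n T) \<longlonglongrightarrow> \<tau> T"
      unfolding \<phi>_def \<tau>_def using H escape by (intro uniform_states_tendsto)
    then show "limitin euclidean (\<lambda>n. \<phi> n T) (\<tau> T) sequentially"
      by simp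
  qed (use \<tau> in simp)
  ultimately have "\<forall>\<^sub>F n in sequentially. \<phi> n \<in> U"
    unfolding limitin_def by blast
  then obtain n where n: "\<phi> n \<in> U"
    by (auto simp: eventually_sequentially)
  define a where "a = (\<lambda>\<xi>\<in>ell2 ?X. \<lambda>h.
      \<Sum>g\<in>F n. of_real (1 / (M * card (F n))) * left_regular G g \<xi> h)"
  have Fn: "finite (F n)" "F n \<subseteq> ?X"
    using F(1)[of n] H(1)[of n] H'(1)[of n] by (auto intro: finite_subset)
  have "card (F n) > 0"
    using Fn F(3) by (simp add: card_gt_0_iff)
  have "\<tau> a = 0"
    unfolding a_def \<tau>_def
      uniform_state_group_algebra[OF finite.insertI[OF finite.emptyI] triv_subgroup Fn]
    using F(2)[of n] by (intro sum.neutral) auto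
  moreover have "\<phi> n a = of_real (1 / M)"
  proof -
    have "\<phi> n a = (\<Sum>g\<in>F n. of_real (1 / (M * card (F n))))"
      unfolding a_def \<phi>_def uniform_state_group_algebra[OF H Fn]
      using F(1)[of n] by (intro sum.cong) auto
    also have "\<dots> = of_real (card (F n) * (1 / (M * card (F n))))"
      by simp
    also have "card (F n) * (1 / (M * card (F n))) = 1 / M"
      using \<open>card (F n) > 0\<close> by simp
    finally show ?thesis .
  qed
  ultimately have "ennreal (1 / M) = ennreal (cmod (\<tau> a - \<phi> n a))"
    using M by (simp only: diff_0 norm_minus_cancel norm_of_real) simp
  also have "a \<in> group_algebra G"
    unfolding a_def group_algebra_def using Fn
    by (intro CollectI exI[of _ "F n"] exI[of _ "\<lambda>_. of_real (1 / (M * card (F n)))"]) auto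
  then have "a \<in> {T \<in> group_algebra G. commutator_norm ?X D T \<le> 1}"
    using comm[of n] by (simp add: a_def)
  then have "ennreal (cmod (\<tau> a - \<phi> n a)) \<le> ?d \<tau> (\<phi> n)"
    unfolding spectral_dist_def by (rule SUP_upper)
  also have "\<dots> < ennreal (1 / M)"
    using n by (simp add: U_def)
  finally show False by simp
qed

section \<open>Prefixes in the free group\<close>

lemma length_foldr_reduced_Cons: "length (foldr reduced_Cons u w) \<le> length u + length w"
proof (induction u)
  case (Cons a u)
  have "length (reduced_Cons a v) \<le> Suc (length v)" for v :: "('a \<times> bool) list"
    by (auto simp: reduced_Cons_def split: list.splits)
  from this[of "foldr reduced_Cons u w"] Cons show ?case
    by simp
qed simp

text \<open>While \<open>reduced_Cons\<close> multiplies by a letter on the left, this is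
  multiplication on the right, that is, one step along an edge of the Cayley tree.\<close>

lemma foldr_reduced_Cons_letter:
  assumes "reduced_word w"
  shows "foldr reduced_Cons w [a] =
    (if w \<noteq> [] \<and> last w = inv_letter a then butlast w else w @ [a])"
  using assms
proof (induction w)
  case (Cons b w)
  then have "reduced_word w" "\<And>c v. w = c # v \<Longrightarrow> c \<noteq> inv_letter b"
    by (auto simp: reduced_word_def successively_Cons)
  with Cons show ?case
    by (cases w) (auto simp: reduced_Cons_def split: list.splits)
qed simp

lemma foldr_reduced_Cons_append:
  assumes "reduced_word (u @ v)"
  shows "foldr reduced_Cons u v = u @ v"
  using foldr_reduced_Cons_Nil[OF assms] assms foldr_reduced_Cons_Nil[of v]
  by (simp add: reduced_word_def successively_append_iff)

lemma reduced_word_take: "reduced_word w \<Longrightarrow> reduced_word (take n w)"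
  by (metis append_take_drop_id reduced_word_def successively_append_iff)

text \<open>The path from \<open>w\<close> to \<open>w\<sigma>\<close> in the Cayley tree reads the letters of \<open>\<sigma>\<close> one at a time, and it
  passes through every prefix of \<open>w\<sigma>\<close> that is not a prefix of \<open>w\<close>.\<close>

lemma take_foldr_reduced_Cons:
  assumes w: "reduced_word w" and \<sigma>: "reduced_word \<sigma>"
  shows "(\<exists>m. take k (foldr reduced_Cons w \<sigma>) = take m w) \<or>
    (\<exists>j. take k (foldr reduced_Cons w \<sigma>) = foldr reduced_Cons w (take j \<sigma>))"
  using \<sigma>
proof (induction \<sigma> arbitrary: k rule: rev_induct)
  case Nil
  then show ?case
    using w by (auto simp: foldr_reduced_Cons_Nil)
next
  case (snoc a \<sigma>)
  define u where "u = foldr reduced_Cons w \<sigma>"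
  from snoc.prems have \<sigma>: "reduced_word \<sigma>"
    by (simp add: reduced_word_def successively_append_iff)
  have u: "reduced_word u"
    using \<sigma> by (simp add: u_def reduced_foldr)
  have "foldr reduced_Cons w (\<sigma> @ [a]) = foldr reduced_Cons u [a]"
    unfolding u_def using snoc.prems
    by (subst foldr_reduced_Cons_assoc) (auto simp: foldr_reduced_Cons_append reduced_word_def)
  then have "foldr reduced_Cons w (\<sigma> @ [a]) = butlast u \<or> foldr reduced_Cons w (\<sigma> @ [a]) = u @ [a]"
    using foldr_reduced_Cons_letter[OF u, of a] by auto
  \<comment> \<open>The last step alters only the end of the word. So a prefix of the new word is a
    prefix of \<open>u\<close>, where the induction hypothesis applies, or it is the whole new
    word.\<close>
  then consider j where "take k (foldr reduced_Cons w (\<sigma> @ [a])) = take j u"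
    | "take k (foldr reduced_Cons w (\<sigma> @ [a])) = foldr reduced_Cons w (\<sigma> @ [a])"
    by (cases "k \<le> length u") (auto simp: butlast_conv_take)
  then show ?case
  proof cases
    case 1
    have "take i \<sigma> = take (min i (length \<sigma>)) (\<sigma> @ [a])" for i
      by (simp add: min_def)
    with snoc.IH[OF \<sigma>, of j] 1 show ?thesis
      unfolding u_def[symmetric] by (metis (no_types))
  next
    case 2
    then show ?thesis
      by (metis order_refl take_all)
  qed
qed

section \<open>Positive words and free prefixes\<close>

definition positive_words :: "nat \<Rightarrow> (nat \<times> bool) list set"
  where "positive_words n = {w. set w \<subseteq> {(0, True), (1, True)} \<and> length w = n}"

lemma finite_positive_words [simp]: "finite (positive_words n)"
  unfolding positive_words_def by (rule finite_lists_length_eq) simp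

lemma card_positive_words: "card (positive_words n) = 2 ^ n"
  unfolding positive_words_def by (subst card_lists_length_eq) (auto simp: numeral_2_eq_2)

lemma reduced_positive: "w \<in> positive_words n \<Longrightarrow> reduced_word w"
proof -
  have "reduced_word w" if "set w \<subseteq> {(0, True), (1, True)}" for w :: "(nat \<times> bool) list"
    using that by (induction w)
      (force simp: reduced_word_def successively_Cons inv_letter_def neq_Nil_conv)+
  then show "w \<in> positive_words n \<Longrightarrow> reduced_word w"
    by (auto simp: positive_words_def)
qed

lemma take_positive_words: "w \<in> positive_words n \<Longrightarrow> k \<le> n \<Longrightarrow> take k w \<in> positive_words k"
  using set_take_subset[of k w] by (auto simp: positive_words_def)

lemma positive_words_subset:
  assumes "d \<ge> 2" shows "positive_words n \<subseteq> carrier (free_group {..<d})"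
proof
  fix w assume w: "w \<in> positive_words n"
  then have "fst ` set w \<subseteq> {..<d}"
    using assms by (auto simp: positive_words_def)
  with reduced_positive[OF w] show "w \<in> carrier (free_group {..<d})"
    by (simp add: free_group_def)
qed

text \<open>Marks the levels \<open>k\<close> on the branch to \<open>t\<close> beyond which no
  other lamp of \<open>E\<close> at a positive word of length \<open>n\<close> is lit. Exempting
  \<open>t\<close> itself makes the predicate invariant under switching the lamp \<open>t\<close>,
  as the Schur test demands of its kernel.\<close>

definition free_prefix :: "nat \<Rightarrow> (nat \<times> bool) list set \<Rightarrow> (nat \<times> bool) list \<Rightarrow> nat \<Rightarrow> bool"
  where "free_prefix n E t k \<longleftrightarrow> (\<forall>u\<in>E \<inter> positive_words n. take k u = take k t \<longrightarrow> u = t)"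

text \<open>Of the \<open>t\<close> with a free prefix of length \<open>k\<close>, up to \<open>2 ^ n\<close> lie outside \<open>E\<close> but at most
  \<open>2 ^ k\<close> lie in \<open>E\<close>. The base \<open>3/2\<close> of the weights is chosen such that both resulting sums,
  with ratios \<open>2/3\<close> and \<open>3/4\<close>, converge.\<close>

lemma free_prefix_sum_le:
  fixes E :: "(nat \<times> bool) list set" and n :: nat
  defines "v \<equiv> \<lambda>t k. if t \<in> E then (3/2::real) ^ (n - k) else (2/3) ^ (n - k)"
  shows "(\<Sum>(t, k)\<in>positive_words n \<times> {..n}. of_bool (free_prefix n E t k) / 2 ^ n * v t k) \<le> 7"
proof -
  let ?P = "positive_words n"
  have level: "(\<Sum>t\<in>?P. of_bool (free_prefix n E t k) / 2 ^ n * v t k)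
      \<le> (2/3) ^ (n - k) + (3/4) ^ (n - k)" if k: "k \<le> n" for k
  proof -
    define U where "U = {t \<in> ?P. t \<in> E \<and> free_prefix n E t k}"
    \<comment> \<open>Members of \<open>U\<close> are lit, so two of them with a common prefix of
      length \<open>k\<close> must coincide, that prefix being free.\<close>
    have "inj_on (take k) U"
      by (rule inj_onI) (auto simp: U_def free_prefix_def)
    moreover have "take k ` U \<subseteq> positive_words k"
      using take_positive_words[OF _ k] by (auto simp: U_def)
    ultimately have "card U \<le> 2 ^ k"
      using card_inj_on_le[of "take k" U "positive_words k"] by (simp add: card_positive_words)
    have U: "U \<subseteq> ?P"
      by (auto simp: U_def)
    \<comment> \<open>Every \<open>t\<close> is charged the small unlit weight, with its indicator
      replaced by 1; the large weight is added only for the lit \<open>t\<close> in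
      \<open>U\<close>.\<close>
    have "(\<Sum>t\<in>?P. of_bool (free_prefix n E t k) / 2 ^ n * v t k)
        \<le> (\<Sum>t\<in>?P. (2/3) ^ (n - k) / 2 ^ n + (if t \<in> U then (3/2) ^ (n - k) / 2 ^ n else 0))"

      unfolding v_def U_def by (intro sum_mono) simp
    also have "\<dots> = (2/3) ^ (n - k) + card U * ((3/2) ^ (n - k) / 2 ^ n)"
      using U by (simp add: sum.distrib card_positive_words sum.If_cases Int_absorb1)
    also have "\<dots> \<le> (2/3) ^ (n - k) + 2 ^ k * ((3/2) ^ (n - k) / 2 ^ n)"
      using \<open>card U \<le> 2 ^ k\<close>
      by (intro add_left_mono mult_right_mono) simp_all
    also have "2 ^ k * ((3/2) ^ (n - k) / 2 ^ n) = (3/4 :: real) ^ (n - k)"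
    proof -
      have "(2::real) ^ n = 2 ^ k * 2 ^ (n - k)"
        using k by (simp flip: power_add)
      moreover have "(4::real) ^ (n - k) = 2 ^ (n - k) * 2 ^ (n - k)"
        by (simp flip: power_mult_distrib)
      ultimately show ?thesis
        by (simp add: power_divide field_simps)
    qed
    finally show ?thesis .
  qed
  have geom: "(\<Sum>k\<le>n. q ^ (n - k)) \<le> 1 / (1 - q)" if "0 \<le> q" "q < 1" for q :: real
  proof -
    have "(\<Sum>k\<le>n. q ^ (n - k)) = (\<Sum>k\<le>n. q ^ k)"
      by (rule sum.reindex_bij_witness[of _ "\<lambda>k. n - k" "\<lambda>k. n - k"]) auto
    also have "\<dots> = (1 - q ^ Suc n) / (1 - q)"
      using that by (simp add: sum_gp0)
    also have "\<dots> \<le> 1 / (1 - q)"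
      using that by (intro divide_right_mono) auto
    finally show ?thesis .
  qed
  have "(\<Sum>(t, k)\<in>?P \<times> {..n}. of_bool (free_prefix n E t k) / 2 ^ n * v t k)
      = (\<Sum>k\<le>n. \<Sum>t\<in>?P. of_bool (free_prefix n E t k) / 2 ^ n * v t k)"
    by (subst sum.swap) (rule sum.cartesian_product[symmetric])
  also have "\<dots> \<le> (\<Sum>k\<le>n. (2/3) ^ (n - k) + (3/4) ^ (n - k))"
    using level by (intro sum_mono) auto
  \<comment> \<open>The two geometric sums are at most 1/(1 - 2/3) = 3 and 1/(1 - 3/4) = 4.\<close>
  also have "\<dots> \<le> 7"
    using geom[of "2/3"] geom[of "3/4"] by (simp add: sum.distrib)
  finally show ?thesis .
qed

section \<open>Word length on the lamplighter group\<close>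

context group
begin

lemma foldr_mult_closed: "set ws \<subseteq> carrier G \<Longrightarrow> foldr (\<otimes>) ws \<one> \<in> carrier G"
  by (induction ws) auto

lemma foldr_mult_append:
  assumes "set us \<subseteq> carrier G" "set vs \<subseteq> carrier G"
  shows "foldr (\<otimes>) (us @ vs) \<one> = foldr (\<otimes>) us \<one> \<otimes> foldr (\<otimes>) vs \<one>"
  using assms by (induction us) (auto simp: m_assoc foldr_mult_closed)

text \<open>\<open>generate\<close> admits inverses of generators, whereas
  \<open>word_length\<close> uses products of elements of \<open>S\<close> only; symmetry of
  \<open>S\<close> reconciles the two. Hence the minimum in \<open>word_length\<close> is attained
  on the generated subgroup.\<close>

lemma generate_symmetric:
  assumes S: "S \<subseteq> carrier G" "(\<lambda>s. inv s) ` S = S" and "g \<in> generate G S"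
  shows "\<exists>ws. set ws \<subseteq> S \<and> foldr (\<otimes>) ws \<one> = g"
  using assms(3)
proof (induction rule: generate.induct)
  case one
  show ?case
    by (rule exI[of _ "[]"]) simp
next
  case (incl s)
  then show ?case
    using S by (intro exI[of _ "[s]"]) auto
next
  case (inv s)
  then show ?case
    using S by (intro exI[of _ "[inv s]"]) auto
next
  case (eng g h)
  then obtain us vs where "set us \<subseteq> S" "foldr (\<otimes>) us \<one> = g" "set vs \<subseteq> S" "foldr (\<otimes>) vs \<one> = h"
    by auto
  then show ?case
    using S(1) by (intro exI[of _ "us @ vs"]) (auto simp del: foldr_append intro!: foldr_mult_append)
qed

lemma word_length_le:
  assumes "set ws \<subseteq> S"
  shows "word_length G S (foldr (\<otimes>) ws \<one>) \<le> length ws"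
  unfolding word_length_def using assms by (intro Least_le) blast

lemma word_length_witness:
  assumes "S \<subseteq> carrier G" "(\<lambda>s. inv s) ` S = S" "g \<in> generate G S"
  obtains ws where "length ws = word_length G S g" "set ws \<subseteq> S" "foldr (\<otimes>) ws \<one> = g"
proof -
  have "\<exists>n ws. length ws = n \<and> set ws \<subseteq> S \<and> foldr (\<otimes>) ws \<one> = g"
    using generate_symmetric[OF assms] by blast
  from LeastI_ex[OF this] that show ?thesis
    unfolding word_length_def by blast
qed

lemma word_length_mult:
  assumes S: "S \<subseteq> carrier G" "(\<lambda>s. inv s) ` S = S" and gh: "g \<in> generate G S" "h \<in> generate G S"
  shows "word_length G S (g \<otimes> h) \<le> word_length G S g + word_length G S h"
proof -
  obtain us vs where *: "length us = word_length G S g" "set us \<subseteq> S" "foldr (\<otimes>) us \<one> = g"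
    "length vs = word_length G S h" "set vs \<subseteq> S" "foldr (\<otimes>) vs \<one> = h"
    using word_length_witness[OF S] gh by metis
  have "foldr (\<otimes>) (us @ vs) \<one> = g \<otimes> h"
    using foldr_mult_append[of us vs] * S(1) by auto
  then show ?thesis
    using word_length_le[of "us @ vs" S] * by simp
qed

end

section \<open>Walks and lamp switching in the lamplighter group\<close>

locale lamplighter_free =
  fixes d :: nat and G and S
  defines "G \<equiv> lamplighter (free_group {..<d})"
  assumes finite_S: "finite S" and S_carrier: "S \<subseteq> carrier G"
    and S_inv: "(\<lambda>s. inv\<^bsub>G\<^esub> s) ` S = S" and S_generates: "generate G S = carrier G"
begin

sublocale \<Gamma>: group "free_group {..<d}"
  by (rule group_free_group)

sublocale group G
  unfolding G_def by (rule \<Gamma>.group_lamplighter)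

abbreviation "L \<equiv> word_length G S"

lemma carrier_free_iff: "w \<in> carrier (free_group {..<d}) \<longleftrightarrow> reduced_word w \<and> fst ` set w \<subseteq> {..<d}"
  by (simp add: free_group_def)

lemma free_mult: "u \<otimes>\<^bsub>free_group {..<d}\<^esub> v = foldr reduced_Cons u v"
  by (simp add: free_group_def)

lemma free_one: "\<one>\<^bsub>free_group {..<d}\<^esub> = []"
  by (simp add: free_group_def)

lemma take_in_free: "w \<in> carrier (free_group {..<d}) \<Longrightarrow> take k w \<in> carrier (free_group {..<d})"
  using set_take_subset[of k w] by (auto simp: carrier_free_iff reduced_word_take)

lemma mem_carrier_iff: "(E, g) \<in> carrier G \<longleftrightarrow>
    finite E \<and> E \<subseteq> carrier (free_group {..<d}) \<and> g \<in> carrier (free_group {..<d})"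
  by (simp add: G_def lamplighter_def)

lemma mult_eq: "(E, g) \<otimes>\<^bsub>G\<^esub> (F, h) = (sym_diff E (foldr reduced_Cons g ` F), foldr reduced_Cons g h)"
  by (auto simp: G_def lamplighter_def l_coset_def free_mult)

lemma one_eq: "\<one>\<^bsub>G\<^esub> = ({}, [])"
  by (simp add: G_def lamplighter_def free_one)

lemma lamp_mult: "({t}, []) \<otimes>\<^bsub>G\<^esub> (E, g) = (sym_diff {t} E, g)"
  by (simp add: mult_eq)

lemma lamp_inv:
  assumes "t \<in> carrier (free_group {..<d})"
  shows "inv\<^bsub>G\<^esub> ({t}, []) = ({t}, [])"
  using assms by (intro inv_equality) (auto simp: mult_eq one_eq mem_carrier_iff carrier_free_iff)

lemma walk_near_prefix:
  assumes K: "\<And>F h f. (F, h) \<in> S \<Longrightarrow> f \<in> insert h F \<Longrightarrow> length f \<le> K"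
    and "set ws \<subseteq> S" "foldr (\<otimes>\<^bsub>G\<^esub>) ws \<one>\<^bsub>G\<^esub> = (E, g)" "u \<in> insert g E"
  shows "\<exists>us vs \<sigma>. ws = us @ vs \<and> \<sigma> \<in> carrier (free_group {..<d}) \<and> length \<sigma> \<le> K \<and>
    take k u = foldr reduced_Cons (snd (foldr (\<otimes>\<^bsub>G\<^esub>) us \<one>\<^bsub>G\<^esub>)) \<sigma>"
  using assms(2-)
proof (induction ws arbitrary: E g u k rule: rev_induct)
  case Nil
  then show ?case
    by (intro exI[of _ "[]"]) (auto simp: one_eq carrier_free_iff)
next
  case (snoc s ws)
  obtain E' g' where x: "foldr (\<otimes>\<^bsub>G\<^esub>) ws \<one>\<^bsub>G\<^esub> = (E', g')"
    by fastforce
  obtain F h where s: "s = (F, h)"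
    by fastforce
  have sS: "(F, h) \<in> S"
    using snoc.prems s by simp
  have xs: "(E', g') \<in> carrier G" "(F, h) \<in> carrier G"
    using foldr_mult_closed[of ws] snoc.prems x S_carrier s by auto
  have "foldr (\<otimes>\<^bsub>G\<^esub>) (ws @ [s]) \<one>\<^bsub>G\<^esub> = (E', g') \<otimes>\<^bsub>G\<^esub> (F, h)"
    using foldr_mult_append[of ws "[s]"] snoc.prems S_carrier s x xs(2) by auto
  then have E: "E = sym_diff E' (foldr reduced_Cons g' ` F)" "g = foldr reduced_Cons g' h"
    using snoc.prems(2) by (auto simp: mult_eq)
  have old: "\<exists>us vs \<sigma>. ws @ [s] = us @ vs \<and> \<sigma> \<in> carrier (free_group {..<d}) \<and> length \<sigma> \<le> K \<and>
      take m u' = foldr reduced_Cons (snd (foldr (\<otimes>\<^bsub>G\<^esub>) us \<one>\<^bsub>G\<^esub>)) \<sigma>"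
    if "u' \<in> insert g' E'" for u' m
  proof -
    have "set ws \<subseteq> S"
      using snoc.prems(1) by simp
    from snoc.IH[OF this x that, of m] obtain us vs \<sigma> where
      "ws = us @ vs" "\<sigma> \<in> carrier (free_group {..<d})" "length \<sigma> \<le> K"
      "take m u' = foldr reduced_Cons (snd (foldr (\<otimes>\<^bsub>G\<^esub>) us \<one>\<^bsub>G\<^esub>)) \<sigma>"
      by blast
    then show ?thesis
      by (intro exI[of _ us] exI[of _ "vs @ [s]"] exI[of _ \<sigma>]) (simp del: foldr_append)
  qed
  show ?case
  proof (cases "u \<in> E'")
    case True
    then show ?thesis
      using old[of u k] by blast
  next
    case False
    then obtain f where f: "f \<in> insert h F" "u = foldr reduced_Cons g' f"
      using snoc.prems(3) E by auto
    have f': "f \<in> carrier (free_group {..<d})" "g' \<in> carrier (free_group {..<d})"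
      using f(1) xs by (auto simp: mem_carrier_iff)
    then consider m where "take k u = take m g'" | j where "take k u = foldr reduced_Cons g' (take j f)"
      using take_foldr_reduced_Cons[of g' f k] f(2) by (auto simp: carrier_free_iff)
    then show ?thesis
    proof cases
      case 1
      then show ?thesis
        using old[of g' m] by simp
    next
      case 2
      then show ?thesis
        using x K[OF sS f(1)] take_in_free[OF f'(1)]
        by (intro exI[of _ ws] exI[of _ "[s]"] exI[of _ "take j f"]) auto
    qed
  qed
qed

text \<open>The lamplighter walks to v, switches the lamp there and walks back: the element is the
  conjugate by v of the lamp at the identity.\<close>

lemma length_lamp:
  obtains C where "\<And>v. v \<in> carrier (free_group {..<d}) \<Longrightarrow> L ({v}, []) \<le> C * (length v + 1)"
proof -
  note wl_mult = word_length_mult[OF S_carrier S_inv, unfolded S_generates]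
  \<comment> \<open>The inserted \<open>0\<close> makes the set nonempty for \<open>Max\<close>,
    also when there are no letters.\<close>
  define c where "c = Max (insert 0 ((\<lambda>a. L ({}, [a])) ` ({..<d} \<times> UNIV)))"
  have c: "L ({}, [a]) \<le> c" if "fst a < d" for a
    unfolding c_def using that by (intro Max_ge) (auto intro!: imageI simp: mem_Times_iff)
  have word: "L ({}, v) \<le> c * length v" if "v \<in> carrier (free_group {..<d})" for v
    using that
  proof (induction v)
    case Nil
    show ?case
      using word_length_le[of "[]" S] by (simp add: one_eq)
  next
    case (Cons a v)
    then have v: "v \<in> carrier (free_group {..<d})" "[a] \<in> carrier (free_group {..<d})" "fst a < d"
      by (auto simp: carrier_free_iff reduced_word_def successively_Cons)
    have "foldr reduced_Cons [a] v = a # v"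
      using Cons.prems foldr_reduced_Cons_append[of "[a]" v] by (simp add: carrier_free_iff)
    then have "({}, a # v) = ({}, [a]) \<otimes>\<^bsub>G\<^esub> ({}, v)"
      by (simp add: mult_eq)
    then have "L ({}, a # v) \<le> L ({}, [a]) + L ({}, v)"
      using wl_mult[of "({}, [a])" "({}, v)"] v by (simp add: mem_carrier_iff)
    then show ?case
      using c[OF v(3)] Cons.IH[OF v(1)] by simp
  qed
  show ?thesis
  proof
    fix v assume v: "v \<in> carrier (free_group {..<d})"
    define v' where "v' = rev (map inv_letter v)"
    have v': "v' \<in> carrier (free_group {..<d})" "length v' = length v"
      using v by (auto simp: carrier_free_iff v'_def reduced_inverse_word)
    have "foldr reduced_Cons v v' = []"
      using foldr_inverse_word[of "[]" v'] foldr_reduced_Cons_Nil[of v'] v'(1)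
      by (simp add: v'_def rev_map o_def carrier_free_iff)
    moreover have "foldr reduced_Cons v [] = v"
      using v by (intro foldr_reduced_Cons_Nil) (simp add: carrier_free_iff)
    ultimately have "({v}, []) = ({}, v) \<otimes>\<^bsub>G\<^esub> (({[]}, []) \<otimes>\<^bsub>G\<^esub> ({}, v'))"
      by (simp add: mult_eq)
    moreover have in_G: "({}, v) \<in> carrier G" "({[]}, []) \<in> carrier G" "({}, v') \<in> carrier G"
      using v v' by (auto simp: mem_carrier_iff carrier_free_iff)
    ultimately have "L ({v}, []) \<le> L ({}, v) + (L ({[]}, []) + L ({}, v'))"
      using wl_mult[OF in_G(1) m_closed[OF in_G(2,3)]] wl_mult[OF in_G(2,3)] by simp
    also have "\<dots> \<le> (2 * c + L ({[]}, [])) * (length v + 1)"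
      using word[OF v] word[OF v'(1)] v'(2) by (simp add: algebra_simps)
    finally show "L ({v}, []) \<le> (2 * c + L ({[]}, [])) * (length v + 1)" .
  qed
qed

text \<open>To switch the lamp \<open>t\<close>, interrupt a shortest walk to \<open>(E, g)\<close> near the common prefix of \<open>t\<close> and
  a lit lamp.\<close>

lemma length_switch_le:
  assumes "d \<ge> 2"
  obtains C where "\<And>E g t n k. (E, g) \<in> carrier G \<Longrightarrow> t \<in> positive_words n \<Longrightarrow> k \<le> n \<Longrightarrow>
    k = 0 \<or> (\<exists>u\<in>E. take k u = take k t) \<Longrightarrow> L (sym_diff {t} E, g) \<le> L (E, g) + C * (n - k + 1)"
proof -
  obtain C where C: "\<And>v. v \<in> carrier (free_group {..<d}) \<Longrightarrow> L ({v}, []) \<le> C * (length v + 1)"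
    using length_lamp by blast
  \<comment> \<open>\<open>K\<close> bounds how far a single generator moves the lamplighter and how
    far from the current position it switches lamps.\<close>
  define K where "K = Max (insert 0 (length ` (\<Union>(F, h)\<in>S. insert h F)))"
  have fin: "finite (\<Union>(F, h)\<in>S. insert h F)"
    using finite_S S_carrier by (auto simp: mem_carrier_iff subset_iff)
  have K: "length f \<le> K" if "(F, h) \<in> S" "f \<in> insert h F" for F h f
    unfolding K_def using fin that by (intro Max_ge) auto
  show ?thesis
  proof
    fix E g t n k
    assume x: "(E, g) \<in> carrier G" and t: "t \<in> positive_words n" and k: "k \<le> n"
      and near: "k = 0 \<or> (\<exists>u\<in>E. take k u = take k t)"
    have len: "length t = n"
      using t by (simp add: positive_words_def)
    have t': "t \<in> carrier (free_group {..<d})"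
      using positive_words_subset[OF assms] t by blast
    obtain ws where ws: "length ws = L (E, g)" "set ws \<subseteq> S" "foldr (\<otimes>\<^bsub>G\<^esub>) ws \<one>\<^bsub>G\<^esub> = (E, g)"
      using word_length_witness[OF S_carrier S_inv, unfolded S_generates, OF x] by blast
    have "\<exists>us vs \<sigma>. ws = us @ vs \<and> \<sigma> \<in> carrier (free_group {..<d}) \<and> length \<sigma> \<le> K \<and>
        take k t = foldr reduced_Cons (snd (foldr (\<otimes>\<^bsub>G\<^esub>) us \<one>\<^bsub>G\<^esub>)) \<sigma>"
    \<comment> \<open>For \<open>k = 0\<close> the prefix is the identity, where every walk starts.
      Otherwise the walk comes close to the prefix on account of the lit lamp
      \<open>u\<close>.\<close>
    proof (cases "k = 0")
      case True
      then show ?thesis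
        by (intro exI[of _ "[]"] exI[of _ ws]) (auto simp: one_eq carrier_free_iff)
    next
      case False
      then obtain u where "u \<in> E" "take k u = take k t"
        using near by blast
      then show ?thesis
        using walk_near_prefix[OF K ws(2,3), where u = u and k = k] by simp
    qed
    then obtain us vs \<sigma> where split: "ws = us @ vs" "\<sigma> \<in> carrier (free_group {..<d})" "length \<sigma> \<le> K"
        "take k t = foldr reduced_Cons (snd (foldr (\<otimes>\<^bsub>G\<^esub>) us \<one>\<^bsub>G\<^esub>)) \<sigma>"
      by blast
    define y where "y = foldr (\<otimes>\<^bsub>G\<^esub>) us \<one>\<^bsub>G\<^esub>"
    define z where "z = foldr (\<otimes>\<^bsub>G\<^esub>) vs \<one>\<^bsub>G\<^esub>"
    have yz: "y \<in> carrier G" "z \<in> carrier G" "y \<otimes>\<^bsub>G\<^esub> z = (E, g)"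
      using foldr_mult_closed[of us] foldr_mult_closed[of vs] foldr_mult_append[of us vs] ws(2,3)
        split(1) S_carrier unfolding y_def z_def by auto
    obtain E1 q where y: "y = (E1, q)"
      by fastforce
    \<comment> \<open>The way from the point of interruption \<open>q\<close> to \<open>t\<close>:
      first the short word \<open>\<sigma>\<close> to \<open>take k t\<close>, then the remaining
      letters of \<open>t\<close>.\<close>
    define v where "v = foldr reduced_Cons \<sigma> (drop k t)"
    have red: "reduced_word (take k t @ drop k t)"
      using t' by (simp add: carrier_free_iff)
    then have "reduced_word (drop k t)"
      unfolding reduced_word_def successively_append_iff by blast
    then have drop: "drop k t \<in> carrier (free_group {..<d})"
      using t' set_drop_subset[of k t] by (auto simp: carrier_free_iff)
    have v: "v \<in> carrier (free_group {..<d})"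
      using \<Gamma>.m_closed[OF split(2) drop] by (simp add: v_def free_mult)
    have qv: "foldr reduced_Cons q v = t"
    proof -
      have "foldr reduced_Cons q \<sigma> = take k t"
        using split(4) y by (simp add: y_def[symmetric])
      then show ?thesis
        using foldr_reduced_Cons_append[OF red] \<open>reduced_word (drop k t)\<close>
        by (simp add: v_def flip: foldr_reduced_Cons_assoc)
    qed
    have "length v \<le> K + (n - k)"
      using length_foldr_reduced_Cons[of \<sigma> "drop k t"] split(3) len by (simp add: v_def)
    have lamp: "({v}, []) \<in> carrier G" "({t}, []) \<in> carrier G"
      using v t' by (simp_all add: mem_carrier_iff carrier_free_iff)
    have "foldr reduced_Cons q [] = q"
      using yz(1) y by (intro foldr_reduced_Cons_Nil) (simp add: mem_carrier_iff carrier_free_iff)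
    \<comment> \<open>Seen from position \<open>q\<close>, the lamp \<open>v\<close> is the lamp
      \<open>t\<close>. So inserting this element between \<open>us\<close> and \<open>vs\<close>
      multiplies the whole product by the lamp \<open>t\<close> on the left.\<close>
    then have "y \<otimes>\<^bsub>G\<^esub> ({v}, []) = ({t}, []) \<otimes>\<^bsub>G\<^esub> y"
      using yz(1) by (auto simp: y mult_eq qv)
    then have "(sym_diff {t} E, g) = y \<otimes>\<^bsub>G\<^esub> (({v}, []) \<otimes>\<^bsub>G\<^esub> z)"
      using yz lamp by (metis lamp_mult m_assoc)
    then have "L (sym_diff {t} E, g) \<le> L y + (L ({v}, []) + L z)"
      using word_length_mult[OF S_carrier S_inv, unfolded S_generates, OF yz(1) m_closed[OF lamp(1) yz(2)]]
        word_length_mult[OF S_carrier S_inv, unfolded S_generates, OF lamp(1) yz(2)]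
      by simp
    moreover have "L y \<le> length us" "L z \<le> length vs"
      unfolding y_def z_def using ws(2) split(1) by (auto intro!: word_length_le)
    moreover have "length us + length vs = L (E, g)"
      using ws(1) split(1) by simp
    moreover have "L ({v}, []) \<le> C * (K + 1) * (n - k + 1)"
    proof -
      have "length v + 1 \<le> (K + 1) * (n - k + 1)"
      proof -
        have "(K + 1) * (m + 1) = K * m + K + m + 1" for m
          by simp
        from this[of "n - k"] \<open>length v \<le> K + (n - k)\<close> show ?thesis
          by linarith
      qed
      then have "C * (length v + 1) \<le> C * ((K + 1) * (n - k + 1))"
        by (rule mult_le_mono2)
      then show ?thesis
        using C[OF v] by (simp only: mult.assoc)
    qed
    ultimately show "L (sym_diff {t} E, g) \<le> L (E, g) + C * (K + 1) * (n - k + 1)"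
      by linarith
  qed
qed

text \<open>Extending a free prefix keeps it free, so the lengths of free prefixes form an interval
  \<open>{k..n}\<close>. Just before it, the prefix is the root or is shared with another lit lamp,
  and \<open>length_switch_le\<close> gives a cost proportional to the number of free levels.
  Switching is an involution that leaves the other lamp lit, so the bound holds in both directions.
  Writing it as a sum over levels prepares the Schur test.\<close>

lemma length_switch_free_prefix:
  assumes "d \<ge> 2"
  obtains C where "\<And>E g t n. (E, g) \<in> carrier G \<Longrightarrow> t \<in> positive_words n \<Longrightarrow>
    \<bar>real (L (E, g)) - real (L (sym_diff {t} E, g))\<bar> \<le> C * (\<Sum>k\<le>n. of_bool (free_prefix n E t k))"
    "C > 0"
proof -
  obtain C where C: "\<And>E g t n k. (E, g) \<in> carrier G \<Longrightarrow> t \<in> positive_words n \<Longrightarrow> k \<le> n \<Longrightarrow>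
    k = 0 \<or> (\<exists>u\<in>E. take k u = take k t) \<Longrightarrow> L (sym_diff {t} E, g) \<le> L (E, g) + C * (n - k + 1)"
    using length_switch_le[OF assms] by blast
  show ?thesis
  proof
    \<comment> \<open>The factor 2 pays for the step back from level \<open>k\<close> to
      \<open>k - 1\<close>; the summand 1 ensures positivity when \<open>C = 0\<close>.\<close>
    show "2 * real C + 1 > 0"
      by simp
    fix E g t n
    assume x: "(E, g) \<in> carrier G" and t: "t \<in> positive_words n"
    define J where "J = {k. k \<le> n \<and> free_prefix n E t k}"
    define k where "k = Min J"
    have "n \<in> J"
      using t by (auto simp: J_def free_prefix_def positive_words_def)
    have "finite J"
      by (simp add: J_def)
    have k: "k \<in> J" "\<And>j. j \<in> J \<Longrightarrow> k \<le> j"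
      unfolding k_def using \<open>finite J\<close> \<open>n \<in> J\<close> by (blast intro: Min_in Min_le)+
    have "{k..n} \<subseteq> J"
    proof
      fix j assume j: "j \<in> {k..n}"
      have "u = t" if u: "u \<in> E \<inter> positive_words n" and eq: "take j u = take j t" for u
      proof -
        have "take k (take j u) = take k (take j t)"
          by (simp only: eq)
        moreover have "min k j = k"
          using j by simp
        ultimately have "take k u = take k t"
          by (simp only: take_take)
        with k(1) u show ?thesis
          unfolding J_def free_prefix_def by blast
      qed
      with j show "j \<in> J"
        unfolding J_def free_prefix_def by simp
    qed
    with \<open>finite J\<close> have "card {k..n} \<le> card J"
      by (rule card_mono)
    moreover have "k \<le> n"
      using k(1) by (simp add: J_def)
    ultimately have card: "n - k + 1 \<le> card J"
      by simp
    have t': "t \<in> carrier (free_group {..<d})"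
      using positive_words_subset[OF assms] t by blast
    \<comment> \<open>Truncated subtraction: the root if \<open>k = 0\<close>, and otherwise the
      last level whose prefix is not free.\<close>
    define k' where "k' = k - 1"
    have k': "k' \<le> n" "n - k' + 1 \<le> 2 * card J"
      using card k(1) by (auto simp: k'_def J_def)
    \<comment> \<open>Minimality of \<open>k\<close> supplies a second lit lamp. Being different
      from \<open>t\<close>, it is lit both before and after the switch.\<close>
    have near: "k' = 0 \<or> (\<exists>u\<in>E - {t}. take k' u = take k' t)"
    proof (cases "k = 0")
      case False
      then have "k' \<notin> J"
        using k(2)[of k'] by (auto simp: k'_def)
      then show ?thesis
        using k'(1) by (auto simp: J_def free_prefix_def)
    qed (simp add: k'_def)
    have x': "(sym_diff {t} E, g) \<in> carrier G"
      using x t' by (auto simp: mem_carrier_iff)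
    have "sym_diff {t} (sym_diff {t} E) = E"
      by blast
    moreover have "L (sym_diff {t} (sym_diff {t} E), g) \<le> L (sym_diff {t} E, g) + C * (n - k' + 1)"
      using near by (intro C[OF x' t k'(1)]) blast
    ultimately have "L (E, g) \<le> L (sym_diff {t} E, g) + C * (n - k' + 1)"
      by simp
    moreover have "L (sym_diff {t} E, g) \<le> L (E, g) + C * (n - k' + 1)"
      using near by (intro C[OF x t k'(1)]) blast
    moreover have "C * (n - k' + 1) \<le> C * (2 * card J)"
      using k'(2) by (rule mult_le_mono2)
    ultimately have "L (E, g) \<le> L (sym_diff {t} E, g) + C * (2 * card J)"
        "L (sym_diff {t} E, g) \<le> L (E, g) + C * (2 * card J)"
      by linarith+
    then have "real (L (E, g)) \<le> real (L (sym_diff {t} E, g)) + C * (2 * card J)"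
        "real (L (sym_diff {t} E, g)) \<le> real (L (E, g)) + C * (2 * card J)"
      by (simp_all flip: of_nat_add of_nat_mult of_nat_numeral only: of_nat_le_iff)
    moreover have "C * (2 * real (card J)) \<le> (2 * real C + 1) * card J"
      by (simp add: algebra_simps)
    moreover have "card J = (\<Sum>k\<le>n. of_bool (free_prefix n E t k))"
    proof -
      have "J = {..n} \<inter> {k. free_prefix n E t k}"
        by (auto simp: J_def)
      then show ?thesis
        by (simp add: sum_of_bool_eq)
    qed
    ultimately show "\<bar>real (L (E, g)) - real (L (sym_diff {t} E, g))\<bar>
        \<le> (2 * real C + 1) * (\<Sum>k\<le>n. of_bool (free_prefix n E t k))"
      by simp
  qed
qed

section \<open>Averages of single-lamp elements\<close>

definition lamps :: "nat \<Rightarrow> ((nat \<times> bool) list set \<times> (nat \<times> bool) list) set"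
  where "lamps n = (\<lambda>t. ({t}, [])) ` positive_words n"

lemma card_lamps: "card (lamps n) = 2 ^ n"
  by (simp add: lamps_def card_image inj_on_def card_positive_words)

text \<open>The commutator with the lamp \<open>t\<close> multiplies by the length difference
  between \<open>h\<close> and its switched copy. The preceding bound distributes this difference
  over the pairs \<open>(t, k)\<close>, and the Schur test with the weights of
  \<open>free_prefix_sum_le\<close> gives a norm bound independent of \<open>n\<close>.\<close>

lemma commutator_norm_lamps:
  assumes "d \<ge> 2"
  obtains M :: real where "M > 0"
    "\<And>n. commutator_norm (carrier G) (length_operator G L)
      (\<lambda>\<xi>\<in>ell2 (carrier G). \<lambda>h.
        \<Sum>g\<in>lamps n. of_real (1 / (M * card (lamps n))) * left_regular G g \<xi> h) \<le> 1"
proof -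
  obtain C where C: "\<And>E g t n. (E, g) \<in> carrier G \<Longrightarrow> t \<in> positive_words n \<Longrightarrow>
    \<bar>real (L (E, g)) - real (L (sym_diff {t} E, g))\<bar> \<le> C * (\<Sum>k\<le>n. of_bool (free_prefix n E t k))"
    "C > 0"
    using length_switch_free_prefix[OF assms] by blast
  let ?X = "carrier G" and ?D = "length_operator G L"
  show ?thesis
  proof
    \<comment> \<open>Here 7 is the bound of \<open>free_prefix_sum_le\<close> and \<open>C\<close>
      the cost of a switch per free level; dividing by both brings the Schur constant down to
      1.\<close>
    show "7 * C > 0"
      using C(2) by simp
    fix n
    define r where "r = 1 / (7 * C * card (lamps n))"
    define a where "a = (\<lambda>\<xi>\<in>ell2 ?X. \<lambda>h. \<Sum>g\<in>lamps n. of_real r * left_regular G g \<xi> h)"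
    have r: "r \<ge> 0" "r * C = 1 / (7 * 2 ^ n)"
      using C(2) by (simp_all add: r_def card_lamps)
    \<comment> \<open>The involution is the same for all \<open>k\<close>; it is listed once per
      level so that each level can carry its own weight.\<close>
    define b where "b = (\<lambda>(t, k::nat) x. ({t}, []) \<otimes>\<^bsub>G\<^esub> x)"
    define \<kappa> :: "(nat \<times> bool) list \<times> nat \<Rightarrow> (nat \<times> bool) list set \<times> (nat \<times> bool) list \<Rightarrow> real"
      where "\<kappa> = (\<lambda>(t, k) x. of_bool (free_prefix n (fst x) t k) / (7 * 2 ^ n))"
    define v :: "(nat \<times> bool) list \<times> nat \<Rightarrow> (nat \<times> bool) list set \<times> (nat \<times> bool) list \<Rightarrow> real"
      where "v = (\<lambda>(t, k) x. if t \<in> fst x then (3/2) ^ (n - k) else (2/3) ^ (n - k))"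
    have lamp: "({t}, []) \<in> ?X" "t \<in> carrier (free_group {..<d})" if "t \<in> positive_words n" for t
    proof -
      show "t \<in> carrier (free_group {..<d})"
        using positive_words_subset[OF assms] that by blast
      then show "({t}, []) \<in> ?X"
        by (simp add: mem_carrier_iff carrier_free_iff)
    qed
    have a: "a \<xi> h = (\<Sum>t\<in>positive_words n. of_real r * \<xi> (b (t, 0) h))"
      if "\<xi> \<in> ell2 ?X" "h \<in> ?X" for \<xi> h
    proof -
      have "a \<xi> h = (\<Sum>t\<in>positive_words n. of_real r * left_regular G ({t}, []) \<xi> h)"
        using that by (simp add: a_def lamps_def sum.reindex inj_on_def)
      also have "\<dots> = (\<Sum>t\<in>positive_words n. of_real r * \<xi> (b (t, 0) h))"
        using that lamp by (intro sum.cong) (auto simp: left_regular_def lamp_inv b_def)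
      finally show ?thesis .
    qed
    have a0: "a \<xi> h = 0" if "\<xi> \<in> ell2 ?X" "h \<notin> ?X" for \<xi> h
      using that by (simp add: a_def left_regular_def)
    have "ell2_norm ?X (\<lambda>h. snd ?D (a \<xi>) h - a (snd ?D \<xi>) h) \<le> 1 * ell2_norm ?X \<xi>"
      if \<xi>D: "\<xi> \<in> fst ?D" for \<xi>
    proof (rule schur_test[where I = "positive_words n \<times> {..n}" and b = b and \<kappa> = \<kappa> and v = v])
      have \<xi>: "\<xi> \<in> ell2 ?X" and D\<xi>: "snd ?D \<xi> \<in> ell2 ?X"
        using \<xi>D by (auto simp: length_operator_def)
      show "\<xi> \<in> ell2 ?X"
        by (rule \<xi>)
      show "snd ?D (a \<xi>) h - a (snd ?D \<xi>) h = 0" if "h \<notin> ?X" for h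
        using a0[OF \<xi> that] a0[OF D\<xi> that] by (simp add: length_operator_def)
      fix h assume h: "h \<in> ?X"
      obtain E g where hEg: "h = (E, g)"
        by fastforce
      show "cmod (snd ?D (a \<xi>) h - a (snd ?D \<xi>) h) \<le>
          (\<Sum>i\<in>positive_words n \<times> {..n}. \<kappa> i h * cmod (\<xi> (b i h)))"
      proof -
        have "snd ?D (a \<xi>) h - a (snd ?D \<xi>) h =
            (\<Sum>t\<in>positive_words n. of_real (r * (real (L h) - real (L (b (t, 0) h)))) * \<xi> (b (t, 0) h))"
          unfolding a[OF D\<xi> h]
          by (simp add: length_operator_def a[OF \<xi> h] sum_distrib_left algebra_simps flip: sum_subtractf)
        also have "cmod \<dots> \<le> (\<Sum>t\<in>positive_words n.
            cmod (of_real (r * (real (L h) - real (L (b (t, 0) h)))) * \<xi> (b (t, 0) h)))"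
          by (rule norm_sum)
        also have "\<dots> \<le> (\<Sum>t\<in>positive_words n. (\<Sum>k\<le>n. \<kappa> (t, k) h) * cmod (\<xi> (b (t, 0) h)))"
        proof (rule sum_mono)
          fix t assume t: "t \<in> positive_words n"
          have "b (t, 0) h = (sym_diff {t} E, g)"
            using h by (simp add: b_def hEg lamp_mult)
          then have "r * \<bar>real (L h) - real (L (b (t, 0) h))\<bar> \<le>
              r * (C * (\<Sum>k\<le>n. of_bool (free_prefix n E t k)))"
            using C(1)[OF h[unfolded hEg] t] r(1) by (simp add: hEg mult_left_mono)
          also have "\<dots> = (\<Sum>k\<le>n. \<kappa> (t, k) h)"
            unfolding mult.assoc[symmetric] r(2) sum_distrib_left by (simp add: \<kappa>_def hEg)
          finally have "cmod (of_real (r * (real (L h) - real (L (b (t, 0) h))))) \<le> (\<Sum>k\<le>n. \<kappa> (t, k) h)"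
            using r(1) by (simp only: norm_of_real abs_mult abs_of_nonneg)
          then show "cmod (of_real (r * (real (L h) - real (L (b (t, 0) h)))) * \<xi> (b (t, 0) h))
              \<le> (\<Sum>k\<le>n. \<kappa> (t, k) h) * cmod (\<xi> (b (t, 0) h))"
            unfolding norm_mult[of _ "\<xi> (b (t, 0) h)"] by (rule mult_right_mono) simp
        qed
        also have "\<dots> = (\<Sum>t\<in>positive_words n. \<Sum>k\<le>n. \<kappa> (t, k) h * cmod (\<xi> (b (t, k) h)))"
          by (simp add: sum_distrib_right b_def)
        also have "\<dots> = (\<Sum>i\<in>positive_words n \<times> {..n}. \<kappa> i h * cmod (\<xi> (b i h)))"
          by (simp add: sum.cartesian_product case_prod_unfold)
        finally show ?thesis .
      qed
      have "(\<Sum>i\<in>positive_words n \<times> {..n}. \<kappa> i h * v i h) =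
          (\<Sum>(t, k)\<in>positive_words n \<times> {..n}. of_bool (free_prefix n E t k) / 2 ^ n *
            (if t \<in> E then (3/2) ^ (n - k) else (2/3) ^ (n - k))) / 7"
        unfolding sum_divide_distrib by (intro sum.cong) (auto simp: \<kappa>_def v_def hEg)
      also have "\<dots> \<le> 1"
        using free_prefix_sum_le[of n E] by simp
      finally show "(\<Sum>i\<in>positive_words n \<times> {..n}. \<kappa> i h * v i h) \<le> 1" .
      fix i assume i: "i \<in> positive_words n \<times> {..n}"
      then obtain t k where tk: "i = (t, k)" "t \<in> positive_words n"
        by auto
      have bh: "b i h = (sym_diff {t} E, g)"
        using h by (simp add: b_def hEg tk lamp_mult)
      show b_in: "b i h \<in> ?X"
        using h lamp[OF tk(2)] by (simp add: b_def tk)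
      have "({t}, []) \<otimes>\<^bsub>G\<^esub> ({t}, []) = \<one>\<^bsub>G\<^esub>"
        using r_inv[OF lamp(1)[OF tk(2)]] by (simp add: lamp_inv lamp(2)[OF tk(2)])
      then show "b i (b i h) = h"
        using h lamp(1)[OF tk(2)] by (simp add: b_def tk flip: m_assoc)
      show "0 \<le> \<kappa> i h" "0 < v i h"
        by (simp_all add: \<kappa>_def v_def tk)
      show "\<kappa> i (b i h) = \<kappa> i h"
        unfolding bh by (auto simp: \<kappa>_def tk hEg free_prefix_def)
      \<comment> \<open>Switching \<open>t\<close> exchanges the lit and the unlit weight, which are
        equal powers of the reciprocal numbers 3/2 and 2/3.\<close>
      show "v i h * v i (b i h) = 1"
        unfolding bh by (auto simp: v_def tk hEg simp flip: power_mult_distrib)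
    qed auto
    then show "commutator_norm ?X ?D (\<lambda>\<xi>\<in>ell2 ?X. \<lambda>h.
        \<Sum>g\<in>lamps n. of_real (1 / (7 * C * card (lamps n))) * left_regular G g \<xi> h) \<le> 1"
      unfolding commutator_norm_def r_def[symmetric] a_def[symmetric]
      by (intro order.trans[OF operator_norm_le[where B = 1]]) auto
  qed
qed

section \<open>The finite lamp subgroups and the conclusion\<close>

definition lamp_subgroup :: "nat \<Rightarrow> ((nat \<times> bool) list set \<times> (nat \<times> bool) list) set"
  where "lamp_subgroup n = Pow (positive_words n) \<times> {[]}"

text \<open>With trivial position, configurations multiply by symmetric difference, so every element
  is its own inverse.\<close>

lemma subgroup_lamp_subgroup:
  assumes "d \<ge> 2" shows "subgroup (lamp_subgroup n) G"
proof (rule subgroupI)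
  show sub: "lamp_subgroup n \<subseteq> carrier G"
    using positive_words_subset[OF assms, of n] finite_subset[OF _ finite_positive_words[of n]]
    by (auto simp: lamp_subgroup_def mem_carrier_iff carrier_free_iff)
  show "lamp_subgroup n \<noteq> {}"
    by (auto simp: lamp_subgroup_def)
  fix x assume x: "x \<in> lamp_subgroup n"
  then have "x \<otimes>\<^bsub>G\<^esub> x = \<one>\<^bsub>G\<^esub>"
    by (auto simp: lamp_subgroup_def mult_eq one_eq)
  then have "inv\<^bsub>G\<^esub> x = x"
    using x sub by (intro inv_equality) auto
  with x show "inv\<^bsub>G\<^esub> x \<in> lamp_subgroup n"
    by simp
  fix y assume "y \<in> lamp_subgroup n"
  with x show "x \<otimes>\<^bsub>G\<^esub> y \<in> lamp_subgroup n"
    by (auto simp: lamp_subgroup_def mult_eq)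
qed

theorem not_spectral_metric_space_lamplighter:
  assumes "d \<ge> 2"
  shows "\<not> spectral_metric_space (carrier G) (reduced_group_cstar_algebra G)
    (group_algebra G) (length_operator G L)"
proof -
  obtain M :: real where M: "M > 0"
    "\<And>n. commutator_norm (carrier G) (length_operator G L)
      (\<lambda>\<xi>\<in>ell2 (carrier G). \<lambda>h.
        \<Sum>g\<in>lamps n. of_real (1 / (M * card (lamps n))) * left_regular G g \<xi> h) \<le> 1"
    using commutator_norm_lamps[OF assms] by blast
  show ?thesis
  proof (rule not_spectral_metric_space[where H = lamp_subgroup and F = lamps and M = M])
    fix n
    show "finite (lamp_subgroup n)"
      by (simp add: lamp_subgroup_def)
    show "subgroup (lamp_subgroup n) G"
      by (rule subgroup_lamp_subgroup[OF assms])
    show "lamps n \<subseteq> lamp_subgroup n" "\<one>\<^bsub>G\<^esub> \<notin> lamps n"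
      by (auto simp: lamps_def lamp_subgroup_def one_eq)
    show "lamps n \<noteq> {}"
      using card_lamps[of n] by force
  next
    fix x assume "x \<in> carrier G" "x \<noteq> \<one>\<^bsub>G\<^esub>"
    obtain E g where x: "x = (E, g)"
      by fastforce
    show "\<forall>\<^sub>F n in sequentially. x \<notin> lamp_subgroup n"
    proof (cases "E = {}")
      case True
      with x \<open>x \<noteq> \<one>\<^bsub>G\<^esub>\<close> show ?thesis
        by (auto simp: lamp_subgroup_def one_eq)
    next
      case False
      then obtain u where "u \<in> E"
        by blast
      \<comment> \<open>Words in \<open>positive_words n\<close> have length exactly
        \<open>n\<close>, so a configuration containing \<open>u\<close> can lie in the subgroup for
        \<open>n = length u\<close> only.\<close>
      then have "x \<notin> lamp_subgroup n" if "n > length u" for n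
        using that x by (auto simp: lamp_subgroup_def positive_words_def)
      then show ?thesis
        using eventually_gt_at_top[of "length u"] by (rule eventually_mono[rotated])
    qed
  qed (use M in auto)
qed

end

theorem theorem1:
  fixes d :: nat
    and S :: "((nat \<times> bool) list set \<times> (nat \<times> bool) list) set"
  defines "G \<equiv> lamplighter (free_group {..<d})"
  assumes "d \<ge> 2"
    and "finite S" and "S \<subseteq> carrier G"
    and "(\<lambda>s. inv\<^bsub>G\<^esub> s) ` S = S"
    and "generate G S = carrier G"
  shows "\<not> spectral_metric_space (carrier G) (reduced_group_cstar_algebra G)
           (group_algebra G) (length_operator G (word_length G S))"
proof -
  interpret lamplighter_free d G S
    by unfold_locales (use assms in \<open>simp_all add: G_def\<close>)
  show ?thesis
    by (rule not_spectral_metric_space_lamplighter[OF \<open>d \<ge> 2\<close>])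
qed

end
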